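(* Let $G_0$ be a group acting decently on a set $X_0$ with basepoint $x_0$. Let $H$ be a group acting on a set $P$, and let $\Gamma<G^{\oplus}$ be a finitely generated subgroup acting purely elliptically on $X=X_0^{\oplus P}$. If $\mathrm{proj}_H(\Gamma)<H$ is trivial, or $\mathrm{proj}_H(\Gamma)$ has an abelian normal subgroup that contains an element with only finitely many finite orbits on $P$, then $\Gamma$ fixes a point of $X$.
   Context: **Decent action.** An action of a group $G$ on a set $Y$ is *purely elliptic* if every element of $G$ fixes a point of $Y$. An action of $G$ on $Y$ is *decent* if: (1) every subgroup of $G$ with a finite orbit on $Y$ fixes a point of $Y$; and (2) every finitely generated subgroup of $G$ acting purely elliptically on $Y$ fixes a point of $Y$. **Restricted product.** $X=X_0^{\oplus P}$ is the set of all $(y_p)_p\in\prod_{p\in P}X_0$ such that $y_p=x_0$ for all but finitely many $p\in P$. **The group $G^{\oplus}$.** Given actions of $H$ on $P$ and of $G_0$ on $X_0$, the unrestricted wreath product $G_0\wr_P H=\prod_P G_0\rtimes H$ acts on $\prod_P X_0$ by $(ghx)_p=g_p\,x_{h^{-1}p}$ for $g\in\prod_P G_0$, $h\in H$, $x=(x_p)_p\in\prod_P X_0$. $G^{\oplus}$ denotes the subgroup of $G_0\wr_P H$ preserving $X$. For $\Gamma<G_0\wr_P H$, $\mathrm{proj}_H(\Gamma)$ is the image of $\Gamma$ under the projection homomorphism $\prod_P G_0\rtimes H\to H$. The orbits of an element $t\in H$ on $P$ are the orbits of the cyclic group $\langle t\rangle$. *)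

theory Defs
  imports "HOL-Algebra.Algebra"
begin

section \<open>Decent actions\<close>

text \<open>
  Actions are those of \<^theory>\<open>HOL-Algebra.Group_Action\<close>: a group homomorphism from \<open>G\<close> into the
  group of extensional bijections of the set \<open>Y\<close>. The notions below refer to the whole acting
  group; for a subgroup \<open>K\<close> they are used at \<open>G\<lparr>carrier := K\<rparr>\<close>.
\<close>

definition fixes_point :: "('g, 'm) monoid_scheme \<Rightarrow> 'y set \<Rightarrow> ('g \<Rightarrow> 'y \<Rightarrow> 'y) \<Rightarrow> bool" where
  "fixes_point G Y \<phi> \<longleftrightarrow> (\<exists>y\<in>Y. \<forall>g\<in>carrier G. \<phi> g y = y)"

definition purely_elliptic :: "('g, 'm) monoid_scheme \<Rightarrow> 'y set \<Rightarrow> ('g \<Rightarrow> 'y \<Rightarrow> 'y) \<Rightarrow> bool" where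
  "purely_elliptic G Y \<phi> \<longleftrightarrow> (\<forall>g\<in>carrier G. \<exists>y\<in>Y. \<phi> g y = y)"

definition finitely_generated :: "('g, 'm) monoid_scheme \<Rightarrow> bool" where
  "finitely_generated G \<longleftrightarrow> (\<exists>S. finite S \<and> S \<subseteq> carrier G \<and> generate G S = carrier G)"

locale decent_action = group_action +
  assumes finite_orbit_fixes:
    "\<And>K y. \<lbrakk>subgroup K G; y \<in> E; finite (orbit (G\<lparr>carrier := K\<rparr>) \<phi> y)\<rbrakk>
      \<Longrightarrow> fixes_point (G\<lparr>carrier := K\<rparr>) E \<phi>"
    and purely_elliptic_fixes:
    "\<And>K. \<lbrakk>subgroup K G; finitely_generated (G\<lparr>carrier := K\<rparr>);
        purely_elliptic (G\<lparr>carrier := K\<rparr>) E \<phi>\<rbrakk>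
      \<Longrightarrow> fixes_point (G\<lparr>carrier := K\<rparr>) E \<phi>"

section \<open>Unrestricted wreath products\<close>

text \<open>
  Throughout, \<open>\<rho>\<close> is an action of \<open>H\<close> on \<open>P\<close>, and \<open>\<phi>\<close> an action of \<open>G\<^sub>0\<close> on \<open>X\<^sub>0\<close>. Elements of a
  product over \<open>P\<close> are extensional functions on \<open>P\<close>, and \<open>shift H P \<rho> h\<close> maps \<open>(x\<^sub>p)\<^sub>p\<close> to
  \<open>(x\<^bsub>h\<^sup>-\<^sup>1p\<^esub>)\<^sub>p\<close>, both for group elements and for points.
\<close>

definition shift ::
  "('h, 'm) monoid_scheme \<Rightarrow> 'p set \<Rightarrow> ('h \<Rightarrow> 'p \<Rightarrow> 'p) \<Rightarrow> 'h \<Rightarrow> ('p \<Rightarrow> 'a) \<Rightarrow> 'p \<Rightarrow> 'a" where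
  "shift H P \<rho> h x = (\<lambda>p\<in>P. x (\<rho> (inv\<^bsub>H\<^esub> h) p))"

text \<open>The pair \<open>(g, h)\<close> represents the element \<open>gh\<close> of the semidirect product, so that
  \<open>(gh)(g'h') = (g (hg'h\<^sup>-\<^sup>1)) (hh')\<close> with \<open>hg'h\<^sup>-\<^sup>1\<close> the shift of \<open>g'\<close> by \<open>h\<close>.\<close>

definition wreath_product ::
  "('g, 'm) monoid_scheme \<Rightarrow> ('h, 'n) monoid_scheme \<Rightarrow> 'p set \<Rightarrow> ('h \<Rightarrow> 'p \<Rightarrow> 'p)
    \<Rightarrow> (('p \<Rightarrow> 'g) \<times> 'h) monoid" where
  "wreath_product G\<^sub>0 H P \<rho> =
    \<lparr>carrier = carrier (product_group P (\<lambda>_. G\<^sub>0)) \<times> carrier H,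
     monoid.mult = (\<lambda>(g, h) (g', h').
       (g \<otimes>\<^bsub>product_group P (\<lambda>_. G\<^sub>0)\<^esub> shift H P \<rho> h g', h \<otimes>\<^bsub>H\<^esub> h')),
     one = (\<one>\<^bsub>product_group P (\<lambda>_. G\<^sub>0)\<^esub>, \<one>\<^bsub>H\<^esub>)\<rparr>"

definition wreath_action ::
  "'x set \<Rightarrow> ('g \<Rightarrow> 'x \<Rightarrow> 'x) \<Rightarrow> ('h, 'n) monoid_scheme \<Rightarrow> 'p set \<Rightarrow> ('h \<Rightarrow> 'p \<Rightarrow> 'p)
    \<Rightarrow> ('p \<Rightarrow> 'g) \<times> 'h \<Rightarrow> ('p \<Rightarrow> 'x) \<Rightarrow> 'p \<Rightarrow> 'x" where
  "wreath_action X\<^sub>0 \<phi> H P \<rho> =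
    (\<lambda>(g, h). \<lambda>x\<in>(\<Pi>\<^sub>E p\<in>P. X\<^sub>0). \<lambda>p\<in>P. \<phi> (g p) (shift H P \<rho> h x p))"

section \<open>The restricted product and its stabilizer\<close>

definition restricted_product :: "'x set \<Rightarrow> 'x \<Rightarrow> 'p set \<Rightarrow> ('p \<Rightarrow> 'x) set" where
  "restricted_product X\<^sub>0 x\<^sub>0 P = {y \<in> \<Pi>\<^sub>E p\<in>P. X\<^sub>0. finite {p \<in> P. y p \<noteq> x\<^sub>0}}"

definition G_plus ::
  "('g, 'm) monoid_scheme \<Rightarrow> 'x set \<Rightarrow> ('g \<Rightarrow> 'x \<Rightarrow> 'x) \<Rightarrow> 'x
    \<Rightarrow> ('h, 'n) monoid_scheme \<Rightarrow> 'p set \<Rightarrow> ('h \<Rightarrow> 'p \<Rightarrow> 'p) \<Rightarrow> (('p \<Rightarrow> 'g) \<times> 'h) monoid" where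
  "G_plus G\<^sub>0 X\<^sub>0 \<phi> x\<^sub>0 H P \<rho> =
    (wreath_product G\<^sub>0 H P \<rho>)\<lparr>carrier :=
      {\<gamma> \<in> carrier (wreath_product G\<^sub>0 H P \<rho>).
        wreath_action X\<^sub>0 \<phi> H P \<rho> \<gamma> ` restricted_product X\<^sub>0 x\<^sub>0 P = restricted_product X\<^sub>0 x\<^sub>0 P}\<rparr>"

definition plus_action ::
  "'x set \<Rightarrow> ('g \<Rightarrow> 'x \<Rightarrow> 'x) \<Rightarrow> 'x \<Rightarrow> ('h, 'n) monoid_scheme \<Rightarrow> 'p set \<Rightarrow> ('h \<Rightarrow> 'p \<Rightarrow> 'p)
    \<Rightarrow> ('p \<Rightarrow> 'g) \<times> 'h \<Rightarrow> ('p \<Rightarrow> 'x) \<Rightarrow> 'p \<Rightarrow> 'x" where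
  "plus_action X\<^sub>0 \<phi> x\<^sub>0 H P \<rho> \<gamma> =
    restrict (wreath_action X\<^sub>0 \<phi> H P \<rho> \<gamma>) (restricted_product X\<^sub>0 x\<^sub>0 P)"

text \<open>Orbits of an element \<open>t\<close> of \<open>H\<close>, that is, of the cyclic group it generates.\<close>

definition element_orbits ::
  "('h, 'n) monoid_scheme \<Rightarrow> 'p set \<Rightarrow> ('h \<Rightarrow> 'p \<Rightarrow> 'p) \<Rightarrow> 'h \<Rightarrow> 'p set set" where
  "element_orbits H P \<rho> t = orbits (H\<lparr>carrier := generate H {t}\<rparr>) P \<rho>"

section \<open>Well-definedness\<close>

context
  fixes G\<^sub>0 :: "('g, 'm) monoid_scheme" and X\<^sub>0 :: "'x set" and \<phi>
    and H :: "('h, 'n) monoid_scheme" and P :: "'p set" and \<rho>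
  assumes G0: "group_action G\<^sub>0 X\<^sub>0 \<phi>" and H: "group_action H P \<rho>"
begin

interpretation g0: group_action G\<^sub>0 X\<^sub>0 \<phi> by (rule G0)
interpretation h: group_action H P \<rho> by (rule H)
interpretation g0: group G\<^sub>0 using g0.group_hom by (simp add: group_hom_def)
interpretation h: group H using h.group_hom by (simp add: group_hom_def)

lemma rho_closed: "h \<in> carrier H \<Longrightarrow> p \<in> P \<Longrightarrow> \<rho> h p \<in> P"
  using h.element_image by blast

lemma phi_closed: "g \<in> carrier G\<^sub>0 \<Longrightarrow> x \<in> X\<^sub>0 \<Longrightarrow> \<phi> g x \<in> X\<^sub>0"
  using g0.element_image by blast

lemma rho_one: "p \<in> P \<Longrightarrow> \<rho> \<one>\<^bsub>H\<^esub> p = p"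
  by (metis h.id_eq_one restrict_apply')

lemma phi_one: "x \<in> X\<^sub>0 \<Longrightarrow> \<phi> \<one>\<^bsub>G\<^sub>0\<^esub> x = x"
  by (metis g0.id_eq_one restrict_apply')

lemma shift_closed: "h \<in> carrier H \<Longrightarrow> x \<in> (\<Pi>\<^sub>E p\<in>P. A) \<Longrightarrow> shift H P \<rho> h x \<in> (\<Pi>\<^sub>E p\<in>P. A)"
  unfolding shift_def using rho_closed by (auto simp: PiE_iff)

lemma shift_mult:
  assumes "h \<in> carrier H" "h' \<in> carrier H"
  shows "shift H P \<rho> (h \<otimes>\<^bsub>H\<^esub> h') x = shift H P \<rho> h (shift H P \<rho> h' x)"
  unfolding shift_def using assms
  by (auto simp: fun_eq_iff h.inv_mult_group h.composition_rule rho_closed)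

lemma shift_one: "x \<in> extensional P \<Longrightarrow> shift H P \<rho> \<one>\<^bsub>H\<^esub> x = x"
  unfolding shift_def by (auto simp: fun_eq_iff rho_one extensional_def)

lemma group_wreath_product: "group (wreath_product G\<^sub>0 H P \<rho>)"
proof (rule groupI)
  fix x assume "x \<in> carrier (wreath_product G\<^sub>0 H P \<rho>)"
  then obtain g h where x: "x = (g, h)" "g \<in> (\<Pi>\<^sub>E p\<in>P. carrier G\<^sub>0)" "h \<in> carrier H"
    by (auto simp: wreath_product_def)
  define g' where "g' = (\<lambda>p\<in>P. inv\<^bsub>G\<^sub>0\<^esub> (g (\<rho> h p)))"
  have "(g', inv\<^bsub>H\<^esub> h) \<otimes>\<^bsub>wreath_product G\<^sub>0 H P \<rho>\<^esub> x = \<one>\<^bsub>wreath_product G\<^sub>0 H P \<rho>\<^esub>"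
    using x by (auto simp: wreath_product_def g'_def shift_def fun_eq_iff PiE_iff rho_closed)
  moreover have "(g', inv\<^bsub>H\<^esub> h) \<in> carrier (wreath_product G\<^sub>0 H P \<rho>)"
    using x by (auto simp: wreath_product_def g'_def PiE_iff rho_closed)
  ultimately show "\<exists>y\<in>carrier (wreath_product G\<^sub>0 H P \<rho>).
      y \<otimes>\<^bsub>wreath_product G\<^sub>0 H P \<rho>\<^esub> x = \<one>\<^bsub>wreath_product G\<^sub>0 H P \<rho>\<^esub>" by blast
next
  fix x y z
  assume "x \<in> carrier (wreath_product G\<^sub>0 H P \<rho>)" "y \<in> carrier (wreath_product G\<^sub>0 H P \<rho>)"
    "z \<in> carrier (wreath_product G\<^sub>0 H P \<rho>)"
  then show "x \<otimes>\<^bsub>wreath_product G\<^sub>0 H P \<rho>\<^esub> y \<otimes>\<^bsub>wreath_product G\<^sub>0 H P \<rho>\<^esub> z =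
      x \<otimes>\<^bsub>wreath_product G\<^sub>0 H P \<rho>\<^esub> (y \<otimes>\<^bsub>wreath_product G\<^sub>0 H P \<rho>\<^esub> z)"
    by (auto simp: wreath_product_def h.m_assoc shift_mult)
       (auto simp: shift_def fun_eq_iff PiE_iff rho_closed g0.m_assoc)
next
  fix x assume "x \<in> carrier (wreath_product G\<^sub>0 H P \<rho>)"
  then show "\<one>\<^bsub>wreath_product G\<^sub>0 H P \<rho>\<^esub> \<otimes>\<^bsub>wreath_product G\<^sub>0 H P \<rho>\<^esub> x = x"
    by (auto simp: wreath_product_def shift_one PiE_iff)
       (auto simp: fun_eq_iff PiE_iff extensional_def)
next
  fix x y
  assume "x \<in> carrier (wreath_product G\<^sub>0 H P \<rho>)" "y \<in> carrier (wreath_product G\<^sub>0 H P \<rho>)"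
  then show "x \<otimes>\<^bsub>wreath_product G\<^sub>0 H P \<rho>\<^esub> y \<in> carrier (wreath_product G\<^sub>0 H P \<rho>)"
    by (auto simp: wreath_product_def shift_def PiE_iff rho_closed)
qed (auto simp: wreath_product_def)

lemma wreath_action_closed:
  assumes "\<gamma> \<in> carrier (wreath_product G\<^sub>0 H P \<rho>)" "x \<in> (\<Pi>\<^sub>E p\<in>P. X\<^sub>0)"
  shows "wreath_action X\<^sub>0 \<phi> H P \<rho> \<gamma> x \<in> (\<Pi>\<^sub>E p\<in>P. X\<^sub>0)"
  using assms
  by (auto simp: wreath_product_def wreath_action_def shift_def PiE_iff rho_closed phi_closed)

lemma wreath_action_mult:
  assumes "\<gamma> \<in> carrier (wreath_product G\<^sub>0 H P \<rho>)" "\<delta> \<in> carrier (wreath_product G\<^sub>0 H P \<rho>)"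
    and "x \<in> (\<Pi>\<^sub>E p\<in>P. X\<^sub>0)"
  shows "wreath_action X\<^sub>0 \<phi> H P \<rho> (\<gamma> \<otimes>\<^bsub>wreath_product G\<^sub>0 H P \<rho>\<^esub> \<delta>) x =
    wreath_action X\<^sub>0 \<phi> H P \<rho> \<gamma> (wreath_action X\<^sub>0 \<phi> H P \<rho> \<delta> x)"
proof -
  have "wreath_action X\<^sub>0 \<phi> H P \<rho> \<delta> x \<in> (\<Pi>\<^sub>E p\<in>P. X\<^sub>0)"
    using wreath_action_closed assms by blast
  then show ?thesis
    using assms
    by (auto simp: wreath_product_def wreath_action_def shift_mult)
       (auto simp: shift_def fun_eq_iff PiE_iff rho_closed g0.composition_rule)
qed

lemma wreath_action_one:
  "x \<in> (\<Pi>\<^sub>E p\<in>P. X\<^sub>0) \<Longrightarrow> wreath_action X\<^sub>0 \<phi> H P \<rho> \<one>\<^bsub>wreath_product G\<^sub>0 H P \<rho>\<^esub> x = x"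
  by (auto simp: wreath_product_def wreath_action_def shift_one PiE_iff)
     (auto simp: fun_eq_iff phi_one extensional_def)

lemma group_action_restrict_invariant:
  fixes W :: "('w, 'k) monoid_scheme" and \<alpha> :: "'w \<Rightarrow> 'y \<Rightarrow> 'y"
  assumes W: "group W"
    and closed: "\<And>g x. g \<in> carrier W \<Longrightarrow> x \<in> Y \<Longrightarrow> \<alpha> g x \<in> Y"
    and mult: "\<And>g h x. g \<in> carrier W \<Longrightarrow> h \<in> carrier W \<Longrightarrow> x \<in> Y \<Longrightarrow>
      \<alpha> (g \<otimes>\<^bsub>W\<^esub> h) x = \<alpha> g (\<alpha> h x)"
    and one: "\<And>x. x \<in> Y \<Longrightarrow> \<alpha> \<one>\<^bsub>W\<^esub> x = x"
  shows "group_action W Y (\<lambda>g. restrict (\<alpha> g) Y)"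
proof -
  interpret W: group W by (rule W)
  have bij: "restrict (\<alpha> g) Y \<in> Bij Y" if g: "g \<in> carrier W" for g
  proof -
    have "\<alpha> (inv\<^bsub>W\<^esub> g) (\<alpha> g x) = x" "\<alpha> g (\<alpha> (inv\<^bsub>W\<^esub> g) x) = x" if "x \<in> Y" for x
      using that g one mult[of g "inv\<^bsub>W\<^esub> g"] mult[of "inv\<^bsub>W\<^esub> g" g] by auto
    then have "bij_betw (\<alpha> g) Y Y"
      using closed g by (intro bij_betw_byWitness[where f' = "\<alpha> (inv\<^bsub>W\<^esub> g)"]) auto
    then show ?thesis
      by (simp add: Bij_def cong: bij_betw_cong)
  qed
  have "(\<lambda>g. restrict (\<alpha> g) Y) \<in> hom W (BijGroup Y)"
    by (rule homI) (use bij closed in \<open>auto simp: BijGroup_def compose_def mult fun_eq_iff\<close>)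
  then show ?thesis
    by (simp add: group_action_def group_hom_def group_hom_axioms_def group_BijGroup W)
qed

lemma group_action_wreath:
  "group_action (wreath_product G\<^sub>0 H P \<rho>) (\<Pi>\<^sub>E p\<in>P. X\<^sub>0) (wreath_action X\<^sub>0 \<phi> H P \<rho>)"
proof -
  have "(\<lambda>\<gamma>. restrict (wreath_action X\<^sub>0 \<phi> H P \<rho> \<gamma>) (\<Pi>\<^sub>E p\<in>P. X\<^sub>0)) =
      wreath_action X\<^sub>0 \<phi> H P \<rho>"
    by (auto simp: wreath_action_def fun_eq_iff)
  moreover have "group_action (wreath_product G\<^sub>0 H P \<rho>) (\<Pi>\<^sub>E p\<in>P. X\<^sub>0)
      (\<lambda>\<gamma>. restrict (wreath_action X\<^sub>0 \<phi> H P \<rho> \<gamma>) (\<Pi>\<^sub>E p\<in>P. X\<^sub>0))"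
    by (rule group_action_restrict_invariant)
       (fact group_wreath_product wreath_action_closed wreath_action_mult wreath_action_one)+
  ultimately show ?thesis by metis
qed

lemma subgroup_G_plus:
  "subgroup (carrier (G_plus G\<^sub>0 X\<^sub>0 \<phi> x\<^sub>0 H P \<rho>)) (wreath_product G\<^sub>0 H P \<rho>)"
proof -
  interpret w: group "wreath_product G\<^sub>0 H P \<rho>" by (rule group_wreath_product)
  let ?W = "wreath_product G\<^sub>0 H P \<rho>" and ?X = "restricted_product X\<^sub>0 x\<^sub>0 P"
  let ?a = "wreath_action X\<^sub>0 \<phi> H P \<rho>"
  have sub: "?X \<subseteq> (\<Pi>\<^sub>E p\<in>P. X\<^sub>0)" by (auto simp: restricted_product_def)
  have im_mult: "?a (\<gamma> \<otimes>\<^bsub>?W\<^esub> \<delta>) ` ?X = ?a \<gamma> ` ?a \<delta> ` ?X"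
    if "\<gamma> \<in> carrier ?W" "\<delta> \<in> carrier ?W" for \<gamma> \<delta>
    unfolding image_image using that sub by (intro image_cong wreath_action_mult) auto
  have im_one: "?a \<one>\<^bsub>?W\<^esub> ` ?X = ?X"
    using wreath_action_one sub by (simp add: subset_iff cong: image_cong_simp)
  have car: "carrier (G_plus G\<^sub>0 X\<^sub>0 \<phi> x\<^sub>0 H P \<rho>) = {\<gamma> \<in> carrier ?W. ?a \<gamma> ` ?X = ?X}"
    by (simp add: G_plus_def)
  show ?thesis
    unfolding car
  proof (rule w.subgroupI)
    fix \<gamma> assume "\<gamma> \<in> {\<gamma> \<in> carrier ?W. ?a \<gamma> ` ?X = ?X}"
    then have \<gamma>: "\<gamma> \<in> carrier ?W" "?a \<gamma> ` ?X = ?X" by auto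
    have "?a (inv\<^bsub>?W\<^esub> \<gamma>) ` ?X = ?X"
      using im_mult[of "inv\<^bsub>?W\<^esub> \<gamma>" \<gamma>] im_one \<gamma> by simp
    then show "inv\<^bsub>?W\<^esub> \<gamma> \<in> {\<gamma> \<in> carrier ?W. ?a \<gamma> ` ?X = ?X}"
      using \<gamma> by simp
  next
    show "{\<gamma> \<in> carrier ?W. ?a \<gamma> ` ?X = ?X} \<noteq> {}" using im_one w.one_closed by blast
  next
    fix \<gamma> \<delta>
    assume "\<gamma> \<in> {\<gamma> \<in> carrier ?W. ?a \<gamma> ` ?X = ?X}" "\<delta> \<in> {\<gamma> \<in> carrier ?W. ?a \<gamma> ` ?X = ?X}"
    then show "\<gamma> \<otimes>\<^bsub>?W\<^esub> \<delta> \<in> {\<gamma> \<in> carrier ?W. ?a \<gamma> ` ?X = ?X}"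
      using im_mult[of \<gamma> \<delta>] by simp
  qed blast
qed

lemma group_action_G_plus:
  "group_action (G_plus G\<^sub>0 X\<^sub>0 \<phi> x\<^sub>0 H P \<rho>) (restricted_product X\<^sub>0 x\<^sub>0 P)
    (plus_action X\<^sub>0 \<phi> x\<^sub>0 H P \<rho>)"
proof -
  have g: "group (G_plus G\<^sub>0 X\<^sub>0 \<phi> x\<^sub>0 H P \<rho>)"
    using group.subgroup_imp_group[OF group_wreath_product subgroup_G_plus]
    by (simp add: G_plus_def)
  have sub: "restricted_product X\<^sub>0 x\<^sub>0 P \<subseteq> (\<Pi>\<^sub>E p\<in>P. X\<^sub>0)"
    by (auto simp: restricted_product_def)
  show ?thesis
    unfolding plus_action_def[abs_def]
    by (rule group_action_restrict_invariant[OF g])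
       (use sub wreath_action_mult wreath_action_one in \<open>auto simp: G_plus_def subset_iff\<close>)
qed

end

end

theory Submission
  imports Defs
begin

text \<open>
  \<^bold>\<open>Fibrewise reformulation.\<close> An element \<open>\<gamma> = gh\<close> of the wreath product carries the coordinate at \<open>p\<close>
  to the coordinate at \<open>hp\<close> by the map \<open>v \<mapsto> g\<^bsub>hp\<^esub> v\<close> of \<open>X\<^sub>0\<close>. So \<open>\<Gamma>\<close> acts on the trivial bundle
  \<open>P \<times> X\<^sub>0\<close>, covering its action on \<open>P\<close>; a point of \<open>X\<close> is a section that takes the value \<open>x\<^sub>0\<close>
  almost everywhere, and \<open>\<Gamma>\<close> fixes the point iff the section is invariant. The locale
  \<open>fibred_action\<close> records this structure.

  \<^bold>\<open>Finite orbits in \<open>P\<close>.\<close> If \<open>p\<close> has a finite orbit, its stabilizer is finitely generated by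
  Schreier's argument (\<open>finitely_generated_stabilizer\<close>) and acts purely elliptically on the fibre over \<open>p\<close>;
  decency yields a fixed vector in that fibre, and \<open>\<Gamma>\<close> transports it along the orbit. Hence a
  section that is invariant outside a finite invariant set \<open>F\<close> can be changed over \<open>F\<close> into an
  invariant one (\<open>extend_over_finite_invariant_set\<close>). If \<open>\<Gamma>\<close> acts trivially on \<open>P\<close>, this
  applies to the constant section \<open>x\<^sub>0\<close>, with \<open>F\<close> the set of points where one of finitely many
  generators moves it.

  \<^bold>\<open>Infinite orbits.\<close> Suppose that \<open>\<tau> \<in> \<Gamma>\<close> maps to an element \<open>t\<close> of an abelian normal subgroup
  \<open>A\<close>, and that \<open>t\<close> has finitely many finite orbits. Their union \<open>F\<close> is finite, and it is invariant
  because every conjugate of \<open>t\<close> commutes with \<open>t\<close>. Let \<open>x\<close> be a section fixed by \<open>\<tau>\<close>; it is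
  \<open>\<Gamma>\<close>-invariant off \<open>F\<close>, for the following reasons.

  Two invariant sections of an element agree on each of its infinite orbits: the set where
  they differ is finite and invariant (\<open>sections_agree_on_ray\<close>). So it suffices that, off \<open>F\<close>, the
  section \<open>x\<close> is invariant under each conjugate \<open>\<tau>' = \<gamma>\<tau>\<gamma>\<^sup>-\<^sup>1\<close>, since \<open>\<gamma>x\<close> is \<open>\<tau>'\<close>-invariant.
  Suppose that it is not. The defects of \<open>\<tau>'\<close>, i.e. the points over which \<open>\<tau>'\<close> does not preserve
  \<open>x\<close>, form a finite set, and off \<open>F\<close> the element \<open>\<tau>\<^sup>n\<tau>'\<close> has the same defects. For a suitable \<open>n\<close> the orbit of
  \<open>\<tau>\<^sup>n\<tau>'\<close> through a given defect is infinite and meets no other one: in the abelian group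
  \<open>\<langle>t, t'\<rangle>\<close> only finitely many of the directions \<open>t\<^sup>nt'\<close> join two given points
  (\<open>finite_shears_joining_points\<close>). But \<open>\<tau>\<^sup>n\<tau>'\<close> is elliptic, and following its fixed section
  along this orbit from both ends shows that an orbit cannot carry exactly one defect
  (\<open>no_single_defect\<close>).
\<close>

section \<open>Group actions\<close>

context group_action
begin

sublocale acting: group G
  using group_hom by (simp add: group_hom_def)

lemma action_one: "x \<in> E \<Longrightarrow> \<phi> \<one> x = x"
  by (metis id_eq_one restrict_apply')

lemma action_closed: "g \<in> carrier G \<Longrightarrow> x \<in> E \<Longrightarrow> \<phi> g x \<in> E"
  using element_image by blast

lemma action_inj: "g \<in> carrier G \<Longrightarrow> x \<in> E \<Longrightarrow> y \<in> E \<Longrightarrow> \<phi> g x = \<phi> g y \<longleftrightarrow> x = y"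
  using inj_prop by (meson inj_on_eq_iff)

lemma action_inv_left: "g \<in> carrier G \<Longrightarrow> x \<in> E \<Longrightarrow> \<phi> (inv g) (\<phi> g x) = x"
  using orbit_sym_aux by blast

lemma action_inv_right: "g \<in> carrier G \<Longrightarrow> x \<in> E \<Longrightarrow> \<phi> g (\<phi> (inv g) x) = x"
  using action_inv_left[of "inv g" x] by simp

lemma action_pow_fixed:
  assumes g: "g \<in> carrier G" and x: "x \<in> E" and fixd: "\<phi> g x = x"
  shows "\<phi> (g [^] (k::int)) x = x"
proof -
  have "g [^] k \<in> stabilizer G \<phi> x"
    using acting.subgroup_int_pow_closed[OF stabilizer_subgroup[OF x], of g k] g fixd
    by (simp add: stabilizer_def)
  then show ?thesis by (simp add: stabilizer_def)
qed

text \<open>Schreier's lemma, with the orbit as the index set of a transversal \<open>r\<close>. The elements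
  \<open>r(gy)\<^sup>-\<^sup>1 g r(y)\<close>, the loops at \<open>x\<close> obtained by closing up the edge from \<open>y\<close> to \<open>gy\<close>, are
  multiplicative along paths, so that the loops of the generators generate all of them; and the loop
  of a stabilizing element at \<open>x\<close> is that element itself.\<close>

lemma finitely_generated_stabilizer:
  assumes fg: "finitely_generated G" and x: "x \<in> E" and fin: "finite (orbit G \<phi> x)"
  shows "finitely_generated (G\<lparr>carrier := stabilizer G \<phi> x\<rparr>)"
proof -
  obtain S where S: "finite S" "S \<subseteq> carrier G" "generate G S = carrier G"
    using fg by (auto simp: finitely_generated_def)
  \<comment> \<open>The representative of \<open>x\<close> itself has to be \<open>\<one>\<close>, for the loop of \<open>g\<close> at \<open>x\<close> to be \<open>g\<close>.\<close>
  have "\<forall>y\<in>orbit G \<phi> x. \<exists>g. g \<in> carrier G \<and> \<phi> g x = y \<and> (y = x \<longrightarrow> g = \<one>)"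
  proof
    fix y assume "y \<in> orbit G \<phi> x"
    then show "\<exists>g. g \<in> carrier G \<and> \<phi> g x = y \<and> (y = x \<longrightarrow> g = \<one>)"
      using x by (cases "y = x") (auto simp: orbit_def action_one)
  qed
  then obtain r where r: "\<And>y. y \<in> orbit G \<phi> x \<Longrightarrow> r y \<in> carrier G"
      "\<And>y. y \<in> orbit G \<phi> x \<Longrightarrow> \<phi> (r y) x = y" and "x \<in> orbit G \<phi> x \<Longrightarrow> r x = \<one>"
    by metis
  then have rx: "r x = \<one>" using orbit_refl x by blast
  have orb: "\<phi> g y \<in> orbit G \<phi> x" "y \<in> E" if "y \<in> orbit G \<phi> x" "g \<in> carrier G" for g y
    using that x action_closed by (auto simp: orbit_def simp flip: composition_rule)
  define loop where "loop = (\<lambda>g y. inv (r (\<phi> g y)) \<otimes> g \<otimes> r y)"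
  have loop_mult: "loop (g \<otimes> h) y = loop g (\<phi> h y) \<otimes> loop h y"
    if "g \<in> carrier G" "h \<in> carrier G" "y \<in> orbit G \<phi> x" for g h y
  proof -
    let ?a = "r (\<phi> g (\<phi> h y))" and ?b = "r (\<phi> h y)"
    have car: "?a \<in> carrier G" "?b \<in> carrier G" "r y \<in> carrier G" "y \<in> E"
      using that orb r by auto
    have "?b \<otimes> (inv ?b \<otimes> (h \<otimes> r y)) = h \<otimes> r y"
      using car that by (simp flip: acting.m_assoc)
    then have "inv ?a \<otimes> g \<otimes> ?b \<otimes> (inv ?b \<otimes> h \<otimes> r y) = inv ?a \<otimes> (g \<otimes> h) \<otimes> r y"
      using car that by (simp add: acting.m_assoc)
    then show ?thesis
      using that car by (simp add: loop_def composition_rule)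
  qed
  define T where "T = (\<lambda>(s, y). loop s y) ` (S \<times> orbit G \<phi> x)"
  have loop_stab: "loop g y \<in> stabilizer G \<phi> x" if "g \<in> carrier G" "y \<in> orbit G \<phi> x" for g y
  proof -
    have "\<phi> (loop g y) x = \<phi> (inv (r (\<phi> g y))) (\<phi> (r (\<phi> g y)) x)"
      using that r orb x by (simp add: loop_def composition_rule action_closed)
    then show ?thesis
      using that r orb x action_inv_left[of "r (\<phi> g y)" x] by (simp add: stabilizer_def loop_def)
  qed
  have T_stab: "T \<subseteq> stabilizer G \<phi> x"
    using S loop_stab by (auto simp: T_def)
  then have T_car: "T \<subseteq> carrier G" using stabilizer_subset by blast
  have loop_gen: "loop g y \<in> generate G T" if "g \<in> generate G S" "y \<in> orbit G \<phi> x" for g y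
    using that
  proof (induction arbitrary: y rule: generate.induct)
    case one
    then show ?case
      using r orb[OF one acting.one_closed] generate.one by (simp add: loop_def action_one)
  next
    case (incl s)
    then show ?case by (auto simp: T_def intro!: generate.incl)
  next
    case (inv s)
    let ?y = "\<phi> (inv s) y"
    have s: "s \<in> carrier G" "y \<in> E" "?y \<in> orbit G \<phi> x" "\<phi> s ?y = y"
      using inv S orb by (auto simp: action_inv_right)
    have "loop (s \<otimes> inv s) y = \<one>"
      using inv s r by (simp add: loop_def action_one)
    then have "loop s ?y \<otimes> loop (inv s) y = \<one>"
      using loop_mult[of s "inv s" y] s inv by simp
    then have "loop (inv s) y = inv (loop s ?y)"
      using loop_stab s inv acting.inv_equality acting.inv_comm stabilizer_subset
      by (metis acting.inv_closed subset_iff)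
    moreover have "loop s ?y \<in> T"
      using inv s by (auto simp: T_def)
    ultimately show ?case by (simp add: generate.inv)
  next
    case (eng g h)
    then have "g \<in> carrier G" "h \<in> carrier G"
      using S by auto
    then show ?case
      using eng loop_mult orb generate.eng by metis
  qed
  have "stabilizer G \<phi> x \<subseteq> generate G T"
  proof
    fix g assume g: "g \<in> stabilizer G \<phi> x"
    then have "loop g x = g" by (simp add: loop_def stabilizer_def rx)
    then show "g \<in> generate G T"
      using loop_gen[of g x] g S orbit_refl[OF x] by (simp add: stabilizer_def)
  qed
  moreover have "generate G T \<subseteq> stabilizer G \<phi> x"
    using acting.generate_subgroup_incl[OF T_stab stabilizer_subgroup[OF x]] .
  moreover have "generate (G\<lparr>carrier := stabilizer G \<phi> x\<rparr>) T = generate G T"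
    using acting.generate_consistent[OF T_stab stabilizer_subgroup[OF x]] .
  moreover have "finite T"
    using S fin by (simp add: T_def)
  ultimately show ?thesis
    using T_stab by (auto simp: finitely_generated_def)
qed

end

context group
begin

lemma int_pow_commute:
  assumes comm: "a \<otimes> b = b \<otimes> a" and a: "a \<in> carrier G" and b: "b \<in> carrier G"
  shows "a \<otimes> b [^] (k::int) = b [^] k \<otimes> a"
proof -
  have "subgroup {x \<in> carrier G. a \<otimes> x = x \<otimes> a} G"
  proof (rule subgroupI)
    fix x assume "x \<in> {x \<in> carrier G. a \<otimes> x = x \<otimes> a}"
    then have x: "x \<in> carrier G" "a \<otimes> x = x \<otimes> a" by auto
    have "a \<otimes> inv x = inv x \<otimes> a"
      using x a by (metis inv_closed inv_solve_left inv_solve_right m_assoc m_closed)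
    then show "inv x \<in> {x \<in> carrier G. a \<otimes> x = x \<otimes> a}" using x by simp
  next
    fix x y assume "x \<in> {x \<in> carrier G. a \<otimes> x = x \<otimes> a}" "y \<in> {x \<in> carrier G. a \<otimes> x = x \<otimes> a}"
    then show "x \<otimes> y \<in> {x \<in> carrier G. a \<otimes> x = x \<otimes> a}"
      using a by simp (metis m_assoc)
  qed (use a in auto)
  from subgroup_int_pow_closed[OF this, of b k] show ?thesis using comm b by simp
qed

end

context group_action
begin

text \<open>The exponents \<open>v \<in> \<int>\<^sup>2\<close> for which \<open>a\<^bsup>v\<^sub>1\<^esup>b\<^bsup>v\<^sub>2\<^esup>\<close> carries \<open>d\<close> to \<open>d'\<close> form a coset of the stabilizer of
  \<open>d\<close> in \<open>\<int>\<^sup>2\<close>. Since no nonzero power of \<open>b\<close> fixes \<open>d\<close>, this stabilizer meets the second axis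
  trivially, so the coset lies on a line that is not vertical. Such a line contains points
  \<open>(k, nk)\<close> with \<open>k \<noteq> 0\<close> for finitely many slopes \<open>n\<close> only.\<close>

lemma finite_shears_joining_points:
  assumes comm: "a \<otimes> b = b \<otimes> a" and a: "a \<in> carrier G" and b: "b \<in> carrier G"
    and d: "d \<in> E" and free: "\<And>k::int. \<phi> (b [^] k) d = d \<Longrightarrow> k = 0"
  shows "finite {n::int. \<exists>k::int. k \<noteq> 0 \<and> \<phi> ((b [^] n \<otimes> a) [^] k) d = d'}"
    (is "finite ?N")
proof -
  define F where "F = (\<lambda>(i::int) (j::int). a [^] i \<otimes> b [^] j)"
  have Fc: "F i j \<in> carrier G" for i j using a b by (simp add: F_def)
  have F_add: "F i j \<otimes> F k l = F (i + k) (j + l)" for i j k l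
  proof -
    have "b [^] j \<otimes> a [^] k = a [^] k \<otimes> b [^] j"
      using a b comm by (metis acting.int_pow_closed acting.int_pow_commute)
    then have "a [^] i \<otimes> (b [^] j \<otimes> a [^] k) \<otimes> b [^] l = a [^] i \<otimes> (a [^] k \<otimes> b [^] j) \<otimes> b [^] l"
      by simp
    then show ?thesis
      using a b by (simp add: F_def acting.int_pow_mult acting.m_assoc)
  qed
  have F_pow: "F i j [^] k = F (i * k) (j * k)" for i j k
  proof -
    have "a [^] i \<otimes> b [^] j = b [^] j \<otimes> a [^] i"
      using a b comm by (metis acting.int_pow_closed acting.int_pow_commute)
    from acting.int_pow_mult_distrib[OF this, of k] show ?thesis
      using a b by (simp add: F_def acting.int_pow_pow)
  qed
  have shear: "(b [^] n \<otimes> a) [^] k = F k (n * k)" for n k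
    using F_pow[of 1 n k] a b acting.int_pow_commute[OF comm a b, of n] by (simp add: F_def)
  have diff: "\<phi> (F (i - k) (j - l)) d = d" if "\<phi> (F i j) d = \<phi> (F k l) d" for i j k l
  proof -
    have "F k l \<otimes> F (i - k) (j - l) = F i j" by (simp add: F_add)
    then show ?thesis
      using that d Fc action_inj composition_rule action_closed by metis
  qed
  have collinear: "i * l = k * j" if "\<phi> (F i j) d = d" "\<phi> (F k l) d = d" for i j k l
  proof -
    have "\<phi> (F i j [^] k) d = d" "\<phi> (F k l [^] i) d = d"
      using action_pow_fixed that Fc d by blast+
    then have "\<phi> (F (i * k) (j * k)) d = \<phi> (F (i * k) (l * i)) d"
      by (simp add: F_pow mult.commute)
    from diff[OF this] have "\<phi> (b [^] (j * k - l * i)) d = d"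
      using b by (simp add: F_def)
    then show ?thesis using free[of "j * k - l * i"] by (simp add: mult.commute)
  qed
  define N where "N = ?N"
  have hit: "\<exists>k. k \<noteq> 0 \<and> \<phi> (F k (n * k)) d = d'" if "n \<in> N" for n
    using that by (auto simp: N_def shear)
  have "finite N"
  proof (rule ccontr)
    assume inf: "infinite N"
    then obtain n1 where n1: "n1 \<in> N" using infinite_imp_nonempty by blast
    have "infinite (N - {n1})" using inf by simp
    then obtain n2 where n: "n2 \<in> N" "n1 \<noteq> n2" using infinite_imp_nonempty by blast
    obtain k1 where k1: "k1 \<noteq> 0" "\<phi> (F k1 (n1 * k1)) d = d'" using hit[OF n1] by blast
    obtain k2 where k2: "k2 \<noteq> 0" "\<phi> (F k2 (n2 * k2)) d = d'" using hit[OF n(1)] by blast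
    note k = k1 k2
    define e where "e = n2 * k2 - n1 * k1"
    have k12: "k1 \<noteq> k2"
    proof
      assume eq: "k1 = k2"
      with diff[of k2 "n2 * k2" k1 "n1 * k1"] k have "\<phi> (b [^] (n2 * k2 - n1 * k1)) d = d"
        using b by (simp add: F_def)
      then show False using free eq k n by fastforce
    qed
    \<comment> \<open>A third solution \<open>(k, mk)\<close> is collinear with \<open>(k1, n1 k1)\<close> and \<open>(k2, n2 k2)\<close>; after cancellation
      \<open>k\<close> divides a nonzero constant with quotient \<open>e - m (k2 - k1)\<close>, which bounds \<open>m\<close>.\<close>
    define B where "B = \<bar>k1 * k2 * (n2 - n1)\<bar> + \<bar>e\<bar>"
    have "N \<subseteq> {-B..B}"
    proof
      fix m assume "m \<in> N"
      then obtain k where k': "k \<noteq> 0" "\<phi> (F k (m * k)) d = d'" using hit by blast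
      have "(k2 - k1) * (m * k - n1 * k1) = (k - k1) * (n2 * k2 - n1 * k1)"
        by (rule collinear; rule diff) (simp_all add: k k')
      then have eq: "k * (e - m * (k2 - k1)) = k1 * k2 * (n2 - n1)"
        by (simp add: e_def algebra_simps)
      have "\<bar>m\<bar> \<le> \<bar>m\<bar> * \<bar>k2 - k1\<bar>"
        using k12 mult_left_mono[of 1 "\<bar>k2 - k1\<bar>" "\<bar>m\<bar>"] by simp
      also have "\<dots> = \<bar>m * (k2 - k1)\<bar>" by (simp add: abs_mult)
      also have "\<dots> \<le> \<bar>e - m * (k2 - k1)\<bar> + \<bar>e\<bar>" by simp
      also have "\<bar>e - m * (k2 - k1)\<bar> \<le> \<bar>k\<bar> * \<bar>e - m * (k2 - k1)\<bar>"
        using k' mult_right_mono[of 1 "\<bar>k\<bar>" "\<bar>e - m * (k2 - k1)\<bar>"] by simp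
      also have "\<dots> = \<bar>k1 * k2 * (n2 - n1)\<bar>" by (simp add: eq flip: abs_mult)
      finally show "m \<in> {-B..B}" by (auto simp: B_def)
    qed
    then show False using inf finite_subset by blast
  qed
  then show ?thesis by (simp only: N_def)
qed


lemma pointwise_commute_BijGroup:
  assumes "a \<in> carrier G" "b \<in> carrier G" "\<And>x. x \<in> E \<Longrightarrow> \<phi> a (\<phi> b x) = \<phi> b (\<phi> a x)"
  shows "\<phi> a \<otimes>\<^bsub>BijGroup E\<^esub> \<phi> b = \<phi> b \<otimes>\<^bsub>BijGroup E\<^esub> \<phi> a"
  using assms bij_prop0 by (auto simp: BijGroup_def compose_def fun_eq_iff)

lemma pointwise_commute_pow:
  assumes a: "a \<in> carrier G" and b: "b \<in> carrier G"
    and comm: "\<And>x. x \<in> E \<Longrightarrow> \<phi> a (\<phi> b x) = \<phi> b (\<phi> a x)" and x: "x \<in> E"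
  shows "\<phi> (a [^] (k::int)) (\<phi> b x) = \<phi> b (\<phi> (a [^] k) x)"
proof -
  interpret B: group_hom G "BijGroup E" \<phi> by (rule group_hom)
  have "\<phi> b \<otimes>\<^bsub>BijGroup E\<^esub> \<phi> (a [^] k) = \<phi> (a [^] k) \<otimes>\<^bsub>BijGroup E\<^esub> \<phi> b"
    using B.H.int_pow_commute[OF pointwise_commute_BijGroup[OF b a], of k] comm a b
    by (simp add: B.hom_int_pow)
  then have "\<phi> (b \<otimes> a [^] k) = \<phi> (a [^] k \<otimes> b)"
    using a b by simp
  then show ?thesis
    using a b x by (metis composition_rule acting.int_pow_closed)
qed

text \<open>The lifts to \<open>\<Gamma>\<close> of commuting elements of \<open>H\<close> do not commute in general, only their actions on \<open>P\<close>
  do. This version applies to them; it is the previous one for the group of permutations of \<open>E\<close>.\<close>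

lemma finite_pointwise_shears_joining_points:
  assumes a: "a \<in> carrier G" and b: "b \<in> carrier G"
    and comm: "\<And>x. x \<in> E \<Longrightarrow> \<phi> a (\<phi> b x) = \<phi> b (\<phi> a x)"
    and d: "d \<in> E" and free: "\<And>k::int. \<phi> (b [^] k) d = d \<Longrightarrow> k = 0"
  shows "finite {n::int. \<exists>k::int. k \<noteq> 0 \<and> \<phi> ((b [^] n \<otimes> a) [^] k) d = d'}"
proof -
  interpret B: group_hom G "BijGroup E" \<phi> by (rule group_hom)
  have "(\<lambda>f. f) \<in> hom (BijGroup E) (BijGroup E)"
    by (simp add: hom_def)
  then have "group_action (BijGroup E) E (\<lambda>f. f)"
    by (simp add: group_action_def group_hom_def group_hom_axioms_def B.H.is_group)
  from group_action.finite_shears_joining_points[OF this pointwise_commute_BijGroup[OF a b comm],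
      of d d']
  show ?thesis
    using a b d free by (simp add: B.hom_int_pow[symmetric] flip: B.hom_mult)
qed

lemma conj_pow:
  assumes "g \<in> carrier G" "t \<in> carrier G"
  shows "(g \<otimes> t \<otimes> inv g) [^] (k::int) = g \<otimes> t [^] k \<otimes> inv g"
proof -
  have "inv g \<otimes> (g \<otimes> y) = y" if "y \<in> carrier G" for y
    using assms that by (simp flip: acting.m_assoc)
  then have "(\<lambda>x. g \<otimes> x \<otimes> inv g) \<in> hom G G"
    using assms by (auto simp: hom_def acting.m_assoc)
  from hom_int_pow[OF this assms(2)] show ?thesis by simp
qed

end

section \<open>Invariant sections of a fibred action\<close>

text \<open>An action of \<open>\<Gamma>\<close> on the bundle \<open>P \<times> X\<^sub>0\<close> that covers an action on \<open>P\<close>: \<open>fib \<gamma> p\<close> maps the fibre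
  over \<open>p\<close> to the fibre over \<open>act \<gamma> p\<close>. The last assumption makes \<open>\<Gamma>\<close> preserve the
  class of sections that equal \<open>x\<^sub>0\<close> almost everywhere.\<close>

locale fibred_action = group_action \<Gamma> P act
  for \<Gamma> :: "('w, 'k) monoid_scheme" (structure) and P :: "'p set" and act +
  fixes X\<^sub>0 :: "'x set" and x\<^sub>0 and fib
  assumes fib_closed: "\<lbrakk>\<gamma> \<in> carrier \<Gamma>; p \<in> P; v \<in> X\<^sub>0\<rbrakk> \<Longrightarrow> fib \<gamma> p v \<in> X\<^sub>0"
    and fib_one: "\<lbrakk>p \<in> P; v \<in> X\<^sub>0\<rbrakk> \<Longrightarrow> fib \<one> p v = v"
    and fib_mult: "\<lbrakk>\<gamma> \<in> carrier \<Gamma>; \<delta> \<in> carrier \<Gamma>; p \<in> P; v \<in> X\<^sub>0\<rbrakk>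
      \<Longrightarrow> fib (\<gamma> \<otimes> \<delta>) p v = fib \<gamma> (act \<delta> p) (fib \<delta> p v)"
    and base_closed: "x\<^sub>0 \<in> X\<^sub>0"
    and fib_base: "\<gamma> \<in> carrier \<Gamma> \<Longrightarrow> finite {p \<in> P. fib \<gamma> p x\<^sub>0 \<noteq> x\<^sub>0}"
begin

definition sections :: "('p \<Rightarrow> 'x) set" where
  "sections = {x. (\<forall>p\<in>P. x p \<in> X\<^sub>0) \<and> finite {p \<in> P. x p \<noteq> x\<^sub>0}}"

text \<open>A section is fixed by \<open>\<gamma>\<close> iff it is invariant at every point. The points where this fails are
  indexed by the source \<open>p\<close>, not by the target \<open>act \<gamma> p\<close>: this way, multiplying \<open>\<gamma>\<close> on the left by an
  element that preserves the section leaves them unchanged.\<close>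

definition invariant_at :: "'w \<Rightarrow> ('p \<Rightarrow> 'x) \<Rightarrow> 'p \<Rightarrow> bool" where
  "invariant_at \<gamma> x p \<longleftrightarrow> fib \<gamma> p (x p) = x (act \<gamma> p)"

lemma sections_closed: "x \<in> sections \<Longrightarrow> p \<in> P \<Longrightarrow> x p \<in> X\<^sub>0"
  by (simp add: sections_def)

lemma finite_disagreement:
  assumes "x \<in> sections" "y \<in> sections" shows "finite {p \<in> P. x p \<noteq> y p}"
  by (rule finite_subset[of _ "{p \<in> P. x p \<noteq> x\<^sub>0} \<union> {p \<in> P. y p \<noteq> x\<^sub>0}"])
     (use assms in \<open>auto simp: sections_def\<close>)

lemma fib_inv:
  assumes "\<gamma> \<in> carrier \<Gamma>" "p \<in> P" "v \<in> X\<^sub>0"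
  shows "fib (inv \<gamma>) (act \<gamma> p) (fib \<gamma> p v) = v"
  using assms fib_mult[of "inv \<gamma>" \<gamma> p v] by (simp add: fib_one)

lemma fib_inj:
  assumes "\<gamma> \<in> carrier \<Gamma>" "p \<in> P" "v \<in> X\<^sub>0" "w \<in> X\<^sub>0"
  shows "fib \<gamma> p v = fib \<gamma> p w \<longleftrightarrow> v = w"
  using assms fib_inv by metis

lemma invariant_at_mult_iff:
  assumes "x \<in> sections" "\<gamma> \<in> carrier \<Gamma>" "\<delta> \<in> carrier \<Gamma>" "p \<in> P" "invariant_at \<gamma> x (act \<delta> p)"
  shows "invariant_at (\<gamma> \<otimes> \<delta>) x p \<longleftrightarrow> invariant_at \<delta> x p"
proof -
  have "x (act (\<gamma> \<otimes> \<delta>) p) = fib \<gamma> (act \<delta> p) (x (act \<delta> p))"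
    using assms by (simp add: invariant_at_def composition_rule)
  moreover have "fib (\<gamma> \<otimes> \<delta>) p (x p) = fib \<gamma> (act \<delta> p) (fib \<delta> p (x p))"
    using assms by (simp add: fib_mult sections_closed)
  ultimately show ?thesis
    using assms fib_inj[of \<gamma> "act \<delta> p" "fib \<delta> p (x p)" "x (act \<delta> p)"]
    by (simp add: invariant_at_def action_closed fib_closed sections_closed)
qed

lemma invariant_at_inv:
  assumes "x \<in> sections" "\<gamma> \<in> carrier \<Gamma>" "p \<in> P" "invariant_at \<gamma> x p"
  shows "invariant_at (inv \<gamma>) x (act \<gamma> p)"
  using assms fib_inv[of \<gamma> p "x p"]
  by (simp add: invariant_at_def sections_closed action_inv_left)

lemma invariant_subgroup:
  assumes x: "x \<in> sections" and Q: "Q \<subseteq> P"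
    and Q_inv: "\<And>\<gamma> q. \<gamma> \<in> carrier \<Gamma> \<Longrightarrow> q \<in> Q \<Longrightarrow> act \<gamma> q \<in> Q"
  shows "subgroup {\<gamma> \<in> carrier \<Gamma>. \<forall>q\<in>Q. invariant_at \<gamma> x q} \<Gamma>" (is "subgroup ?S _")
proof (rule acting.subgroupI)
  have "\<one> \<in> ?S"
    using x Q by (auto simp: invariant_at_def fib_one action_one sections_closed)
  then show "?S \<noteq> {}" by blast
next
  fix \<gamma> assume \<gamma>: "\<gamma> \<in> ?S"
  have "invariant_at (inv \<gamma>) x q" if q: "q \<in> Q" for q
  proof -
    have "act (inv \<gamma>) q \<in> Q" using \<gamma> q Q_inv by simp
    then show ?thesis
      using invariant_at_inv[of x \<gamma> "act (inv \<gamma>) q"] \<gamma> q Q x by (auto simp: action_inv_right subset_iff)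
  qed
  then show "inv \<gamma> \<in> ?S" using \<gamma> by simp
next
  fix \<gamma> \<delta> assume "\<gamma> \<in> ?S" "\<delta> \<in> ?S"
  then show "\<gamma> \<otimes> \<delta> \<in> ?S"
    using invariant_at_mult_iff[of x \<gamma> \<delta>] Q_inv Q x by blast
qed blast

text \<open>Fibre maps are injective, so a disagreement at \<open>d\<close> would propagate to the infinitely many points
  of the forward orbit.\<close>

lemma sections_agree_on_ray:
  assumes s: "s \<in> carrier \<Gamma>" and d: "d \<in> P" and free: "\<And>k::int. act (s [^] k) d = d \<Longrightarrow> k = 0"
    and x: "x \<in> sections" and z: "z \<in> sections"
    and x_inv: "\<And>n::nat. invariant_at s x (act (s [^] int n) d)"
    and z_inv: "\<And>n::nat. invariant_at s z (act (s [^] int n) d)"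
  shows "x d = z d"
proof (rule ccontr)
  assume neq: "x d \<noteq> z d"
  let ?d = "\<lambda>n::nat. act (s [^] int n) d"
  have dP: "?d n \<in> P" for n using s d by (simp add: action_closed)
  have step: "?d (Suc n) = act s (?d n)" for n
  proof -
    have "s [^] int (Suc n) = s \<otimes> s [^] int n"
      using s acting.int_pow_mult[of s 1 "int n"] by simp
    then show ?thesis using s d by (simp add: composition_rule)
  qed
  have "x (?d n) \<noteq> z (?d n)" for n
  proof (induction n)
    case 0
    then show ?case using neq d by (simp add: action_one)
  next
    case (Suc n)
    then have "fib s (?d n) (x (?d n)) \<noteq> fib s (?d n) (z (?d n))"
      using fib_inj s dP x z sections_closed by metis
    then show ?case
      using x_inv[of n] z_inv[of n] unfolding step invariant_at_def by simp
  qed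
  then have "range ?d \<subseteq> {p \<in> P. x p \<noteq> z p}" using dP by blast
  then have "finite (range ?d)" using finite_disagreement[OF x z] finite_subset by blast
  moreover have "inj ?d"
  proof (rule injI)
    fix m n :: nat assume "?d m = ?d n"
    moreover have "s [^] int m = s [^] int n \<otimes> s [^] (int m - int n)"
      using s by (simp flip: acting.int_pow_mult)
    ultimately have "act (s [^] (int m - int n)) d = d"
      using s d action_inj[of "s [^] int n" "act (s [^] (int m - int n)) d" d]
      by (simp add: composition_rule action_closed)
    then show "m = n" using free by fastforce
  qed
  ultimately show False using finite_imageD by blast
qed

text \<open>Compare \<open>x\<close> with the section \<open>z\<close> fixed by \<open>s\<close>. On the ray that starts at \<open>s d\<close> and runs forward, and
  on the ray that starts at \<open>d\<close> and runs backward, both are invariant and hence agree. Thus they agree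
  at both ends of the step from \<open>d\<close> to \<open>s d\<close>, over which \<open>z\<close> is invariant.\<close>

lemma no_single_defect:
  assumes s: "s \<in> carrier \<Gamma>" and d: "d \<in> P" and free: "\<And>k::int. act (s [^] k) d = d \<Longrightarrow> k = 0"
    and x: "x \<in> sections" and z: "z \<in> sections" and z_inv: "\<And>p. p \<in> P \<Longrightarrow> invariant_at s z p"
    and x_inv: "\<And>k::int. k \<noteq> 0 \<Longrightarrow> invariant_at s x (act (s [^] k) d)"
  shows "invariant_at s x d"
proof -
  have pow: "act (s [^] i) (act (s [^] j) d) = act (s [^] (i + j)) d" for i j :: int
    using s d by (simp add: acting.int_pow_mult composition_rule)
  have "x (act s d) = z (act s d)"
  proof (rule sections_agree_on_ray[OF s _ _ x z])
    show "k = 0" if "act (s [^] k) (act s d) = act s d" for k :: int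
    proof -
      have "act s (act (s [^] k) d) = act s d"
        using that pow[of k 1] pow[of 1 k] s by (simp add: add.commute)
      then show ?thesis using free s d by (simp add: action_inj action_closed)
    qed
    show "invariant_at s x (act (s [^] int n) (act s d))" for n
      using x_inv[of "int n + 1"] pow[of "int n" 1] s by simp
  qed (use z_inv s d in \<open>simp_all add: action_closed\<close>)
  moreover have "x d = z d"
  proof (rule sections_agree_on_ray[OF acting.inv_closed[OF s] d _ x z])
    have inv_pow: "inv s [^] k = s [^] (- k)" for k :: int
      using s by (simp add: acting.int_pow_neg acting.int_pow_inv)
    show "k = 0" if "act (inv s [^] k) d = d" for k :: int
      using that free[of "- k"] by (simp add: inv_pow)
    show "invariant_at (inv s) x (act (inv s [^] int n) d)" for n
      using invariant_at_inv[OF x s _ x_inv[of "- int n - 1"]] pow[of 1 "- int n - 1"] s d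
      by (simp add: inv_pow action_closed)
    show "invariant_at (inv s) z (act (inv s [^] int n) d)" for n
      using invariant_at_inv[OF z s _ z_inv, of "act (s [^] (- int n - 1)) d"]
        pow[of 1 "- int n - 1"] s d
      by (simp add: inv_pow action_closed)
  qed
  ultimately show ?thesis using z_inv[OF d] by (simp add: invariant_at_def)
qed

lemma finite_defects:
  assumes "x \<in> sections" "\<gamma> \<in> carrier \<Gamma>"
  shows "finite {p \<in> P. \<not> invariant_at \<gamma> x p}"
proof -
  have "finite {p \<in> P. x (act \<gamma> p) \<noteq> x\<^sub>0}"
  proof (rule finite_imageD)
    show "finite (act \<gamma> ` {p \<in> P. x (act \<gamma> p) \<noteq> x\<^sub>0})"
      by (rule finite_subset[of _ "{p \<in> P. x p \<noteq> x\<^sub>0}"])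
         (use assms in \<open>auto simp: sections_def action_closed\<close>)
    show "inj_on (act \<gamma>) {p \<in> P. x (act \<gamma> p) \<noteq> x\<^sub>0}"
      using inj_prop[OF assms(2)] by (rule inj_on_subset) auto
  qed
  moreover have "finite {p \<in> P. x p \<noteq> x\<^sub>0}" using assms by (simp add: sections_def)
  moreover have "{p \<in> P. \<not> invariant_at \<gamma> x p} \<subseteq>
      {p \<in> P. x (act \<gamma> p) \<noteq> x\<^sub>0} \<union> {p \<in> P. x p \<noteq> x\<^sub>0} \<union> {p \<in> P. fib \<gamma> p x\<^sub>0 \<noteq> x\<^sub>0}"
    by (auto simp: invariant_at_def)
  ultimately show ?thesis
    using fib_base[OF assms(2)] finite_subset by blast
qed

text \<open>The element \<open>s = t\<^sup>n t'\<close> has the same defects in \<open>Q\<close> as \<open>t'\<close>, as \<open>t\<close> preserves \<open>x\<close> there. The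
  exponent \<open>n\<close> is chosen such that the \<open>s\<close>-orbit of the defect \<open>d\<close> neither closes up nor meets
  another defect, which contradicts the previous lemma.\<close>

lemma commuting_element_invariant:
  assumes elliptic: "\<And>\<gamma>. \<gamma> \<in> carrier \<Gamma> \<Longrightarrow> \<exists>z\<in>sections. \<forall>p\<in>P. invariant_at \<gamma> z p"
    and Q: "Q \<subseteq> P" "\<And>\<gamma> q. \<gamma> \<in> carrier \<Gamma> \<Longrightarrow> q \<in> Q \<Longrightarrow> act \<gamma> q \<in> Q"
    and t: "t \<in> carrier \<Gamma>" and free: "\<And>q k::int. q \<in> Q \<Longrightarrow> act (t [^] k) q = q \<Longrightarrow> k = 0"
    and x: "x \<in> sections" and x_inv: "\<And>q. q \<in> Q \<Longrightarrow> invariant_at t x q"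
    and t': "t' \<in> carrier \<Gamma>" and comm: "\<And>p. p \<in> P \<Longrightarrow> act t' (act t p) = act t (act t' p)"
    and d: "d \<in> Q"
  shows "invariant_at t' x d"
proof (rule ccontr)
  assume defect: "\<not> invariant_at t' x d"
  define D where "D = {p \<in> P. \<not> invariant_at t' x p}"
  have dP: "d \<in> P" using d Q by blast
  have dD: "d \<in> D" using dP defect by (simp add: D_def)
  have "finite (\<Union>e\<in>D. {n::int. \<exists>k::int. k \<noteq> 0 \<and> act ((t [^] n \<otimes> t') [^] k) d = e})"
    using finite_defects[OF x t'] finite_pointwise_shears_joining_points[OF t' t comm dP free[OF d]]
    by (simp add: D_def)
  then obtain n :: int where n: "n \<notin> (\<Union>e\<in>D. {n. \<exists>k::int. k \<noteq> 0 \<and> act ((t [^] n \<otimes> t') [^] k) d = e})"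
    using ex_new_if_finite[OF infinite_UNIV_int] by blast
  define s where "s = t [^] n \<otimes> t'"
  have s: "s \<in> carrier \<Gamma>" using t t' by (simp add: s_def)
  have off: "act (s [^] k) d \<notin> D" if "k \<noteq> 0" for k :: int
    using n that by (auto simp: s_def)
  have tn: "invariant_at (t [^] n) x q" if "q \<in> Q" for q
    using acting.subgroup_int_pow_closed[OF invariant_subgroup[OF x Q], of t n] that t x_inv by simp
  have s_iff: "invariant_at s x q \<longleftrightarrow> invariant_at t' x q" if "q \<in> Q" for q
    unfolding s_def using that x t t' Q tn by (intro invariant_at_mult_iff) auto
  obtain z where z: "z \<in> sections" "\<And>p. p \<in> P \<Longrightarrow> invariant_at s z p"
    using elliptic[OF s] by blast
  have "invariant_at s x d"
  proof (rule no_single_defect[OF s dP _ x z])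
    show "k = 0" if "act (s [^] k) d = d" for k :: int
      using off[of k] dD that by auto
    show "invariant_at s x (act (s [^] k) d)" if "k \<noteq> 0" for k :: int
    proof -
      have "act (s [^] k) d \<in> Q" using s d Q by simp
      then show ?thesis using off[OF that] s_iff Q(1) by (auto simp: D_def)
    qed
  qed
  then show False using s_iff[OF d] defect by blast
qed

text \<open>The translate of the section \<open>x\<close> by \<open>\<gamma>\<close>.\<close>

lemma push_section:
  assumes x: "x \<in> sections" and \<gamma>: "\<gamma> \<in> carrier \<Gamma>"
  shows "(\<lambda>p. fib \<gamma> (act (inv \<gamma>) p) (x (act (inv \<gamma>) p))) \<in> sections" (is "?y \<in> _")
proof -
  have "act (inv \<gamma>) p \<in> P" if "p \<in> P" for p using that \<gamma> by (simp add: action_closed)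
  then have cl: "?y p \<in> X\<^sub>0" if "p \<in> P" for p
    using that x \<gamma> by (simp add: fib_closed sections_closed)
  have "{p \<in> P. ?y p \<noteq> x\<^sub>0} \<subseteq> act \<gamma> ` ({p \<in> P. fib \<gamma> p x\<^sub>0 \<noteq> x\<^sub>0} \<union> {p \<in> P. x p \<noteq> x\<^sub>0})"
  proof
    fix p assume p: "p \<in> {p \<in> P. ?y p \<noteq> x\<^sub>0}"
    let ?q = "act (inv \<gamma>) p"
    have "?q \<in> {p \<in> P. fib \<gamma> p x\<^sub>0 \<noteq> x\<^sub>0} \<union> {p \<in> P. x p \<noteq> x\<^sub>0}"
      using p \<gamma> by (auto simp: action_closed)
    moreover have "p = act \<gamma> ?q" using p \<gamma> by (simp add: action_inv_right)
    ultimately show "p \<in> act \<gamma> ` ({p \<in> P. fib \<gamma> p x\<^sub>0 \<noteq> x\<^sub>0} \<union> {p \<in> P. x p \<noteq> x\<^sub>0})" by blast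
  qed
  moreover have "finite (act \<gamma> ` ({p \<in> P. fib \<gamma> p x\<^sub>0 \<noteq> x\<^sub>0} \<union> {p \<in> P. x p \<noteq> x\<^sub>0}))"
    using x fib_base[OF \<gamma>] by (simp add: sections_def)
  ultimately show ?thesis using cl finite_subset unfolding sections_def by blast
qed


text \<open>The union of the finite orbits of \<open>t\<close>.\<close>

definition torsion :: "'w \<Rightarrow> 'p set" where
  "torsion t = {p \<in> P. \<exists>k::int. k \<noteq> 0 \<and> act (t [^] k) p = p}"

text \<open>The conjugate \<open>u = \<gamma>\<^sup>-\<^sup>1t\<gamma>\<close> commutes with \<open>t\<close> on \<open>P\<close> and so permutes the finite set \<open>torsion t\<close>. Hence \<open>p\<close>
  has a finite \<open>u\<close>-orbit, which \<open>\<gamma>\<close> carries to a finite \<open>t\<close>-orbit of \<open>\<gamma> p\<close>.\<close>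

lemma torsion_invariant:
  assumes t: "t \<in> carrier \<Gamma>" and fin: "finite (torsion t)"
    and comm: "\<And>\<gamma> p. \<gamma> \<in> carrier \<Gamma> \<Longrightarrow> p \<in> P \<Longrightarrow>
      act t (act (\<gamma> \<otimes> t \<otimes> inv \<gamma>) p) = act (\<gamma> \<otimes> t \<otimes> inv \<gamma>) (act t p)"
    and \<gamma>: "\<gamma> \<in> carrier \<Gamma>" and p: "p \<in> torsion t"
  shows "act \<gamma> p \<in> torsion t"
proof -
  define u where "u = inv \<gamma> \<otimes> t \<otimes> \<gamma>"
  have u: "u \<in> carrier \<Gamma>" and pP: "p \<in> P" using \<gamma> t p by (auto simp: u_def torsion_def)
  have u_t: "act t (act u q) = act u (act t q)" if "q \<in> P" for q
    using comm[of "inv \<gamma>" q] that \<gamma> by (simp add: u_def)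
  have tors_u: "act (u [^] n) p \<in> torsion t" for n :: int
  proof -
    obtain k :: int where k: "k \<noteq> 0" "act (t [^] k) p = p" using p by (auto simp: torsion_def)
    have "act (u [^] n) (act (t [^] k) p) = act (t [^] k) (act (u [^] n) p)"
      using pP t u by (intro pointwise_commute_pow) (auto simp: pointwise_commute_pow u_t)
    then show ?thesis using k pP u by (auto simp: torsion_def action_closed)
  qed
  have "\<not> inj (\<lambda>n::int. act (u [^] n) p)"
  proof
    assume "inj (\<lambda>n::int. act (u [^] n) p)"
    moreover have "finite (range (\<lambda>n::int. act (u [^] n) p))"
      by (rule finite_subset[OF _ fin]) (use tors_u in auto)
    ultimately show False using finite_imageD[of _ "UNIV :: int set"] infinite_UNIV_int by metis
  qed
  then obtain m n :: int where mn: "m \<noteq> n" "act (u [^] m) p = act (u [^] n) p"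
    by (auto simp: inj_def)
  have "act (u [^] n) (act (u [^] (m - n)) p) = act (u [^] n) p"
    using mn u pP by (simp flip: composition_rule acting.int_pow_mult)
  then have fixd: "act (u [^] (m - n)) p = p"
    using u pP by (simp add: action_inj action_closed)
  have "u [^] (m - n) = inv \<gamma> \<otimes> t [^] (m - n) \<otimes> \<gamma>"
    using conj_pow[of "inv \<gamma>" t "m - n"] \<gamma> t by (simp add: u_def)
  then have "act (inv \<gamma>) (act (t [^] (m - n)) (act \<gamma> p)) = p"
    using fixd \<gamma> t pP by (simp add: composition_rule action_closed)
  then have "act (t [^] (m - n)) (act \<gamma> p) = act \<gamma> p"
    using \<gamma> t pP action_inv_right[of \<gamma> "act (t [^] (m - n)) (act \<gamma> p)"] by (simp add: action_closed)
  then show ?thesis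
    using mn \<gamma> pP unfolding torsion_def by (auto simp: action_closed intro!: exI[of _ "m - n"])
qed

text \<open>Let \<open>u = \<gamma>t\<gamma>\<^sup>-\<^sup>1\<close>. Off the torsion, both \<open>x\<close> and its translate by \<open>\<gamma>\<close> are invariant under \<open>u\<close>, the
  latter because \<open>t\<close> preserves \<open>x\<close>. As the orbits of \<open>u\<close> there are infinite, the two sections agree.\<close>

lemma invariant_off_torsion:
  assumes elliptic: "\<And>\<gamma>. \<gamma> \<in> carrier \<Gamma> \<Longrightarrow> \<exists>z\<in>sections. \<forall>p\<in>P. invariant_at \<gamma> z p"
    and t: "t \<in> carrier \<Gamma>" and fin: "finite (torsion t)"
    and comm: "\<And>\<gamma> p. \<gamma> \<in> carrier \<Gamma> \<Longrightarrow> p \<in> P \<Longrightarrow>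
      act t (act (\<gamma> \<otimes> t \<otimes> inv \<gamma>) p) = act (\<gamma> \<otimes> t \<otimes> inv \<gamma>) (act t p)"
    and x: "x \<in> sections" and x_inv: "\<And>p. p \<in> P \<Longrightarrow> invariant_at t x p"
    and \<gamma>: "\<gamma> \<in> carrier \<Gamma>" and q: "q \<in> P - torsion t"
  shows "invariant_at \<gamma> x q"
proof -
  define Q where "Q = P - torsion t"
  have Q: "act \<delta> p \<in> Q" if "\<delta> \<in> carrier \<Gamma>" "p \<in> Q" for \<delta> p
    using that torsion_invariant[OF t fin comm, of "inv \<delta>" "act \<delta> p"]
    by (auto simp: Q_def action_closed action_inv_left)
  define u where "u = \<gamma> \<otimes> t \<otimes> inv \<gamma>"
  have u: "u \<in> carrier \<Gamma>" using \<gamma> t by (simp add: u_def)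
  have u_inv: "invariant_at u x p" if "p \<in> Q" for p
  proof (rule commuting_element_invariant[OF elliptic _ Q t _ x _ u _ that])
    show "act u (act t p) = act t (act u p)" if "p \<in> P" for p
      using comm[OF \<gamma> that] by (simp add: u_def)
  qed (auto simp: Q_def torsion_def x_inv)
  define y where "y = (\<lambda>p. fib \<gamma> (act (inv \<gamma>) p) (x (act (inv \<gamma>) p)))"
  have y: "y \<in> sections" unfolding y_def using push_section[OF x \<gamma>] .
  have y_at: "y (act \<gamma> p) = fib \<gamma> p (x p)" if "p \<in> P" for p
    using that \<gamma> by (simp add: y_def action_inv_left)
  have u\<gamma>: "u \<otimes> \<gamma> = \<gamma> \<otimes> t" using \<gamma> t by (simp add: u_def acting.m_assoc)
  have y_inv: "invariant_at u y (act \<gamma> p)" if p: "p \<in> P" for p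
  proof -
    have "fib u (act \<gamma> p) (fib \<gamma> p (x p)) = fib \<gamma> (act t p) (fib t p (x p))"
      using p \<gamma> t u x u\<gamma> by (simp add: sections_closed flip: fib_mult)
    also have "\<dots> = y (act \<gamma> (act t p))"
      using x_inv[OF p] p t by (simp add: invariant_at_def y_at action_closed)
    also have "act \<gamma> (act t p) = act u (act \<gamma> p)"
      using p \<gamma> t u u\<gamma> by (simp flip: composition_rule)
    finally show ?thesis using p by (simp add: invariant_at_def y_at)
  qed
  have qP: "q \<in> P" and qQ: "q \<in> Q" using q by (auto simp: Q_def)
  have "x (act \<gamma> q) = y (act \<gamma> q)"
  proof (rule sections_agree_on_ray[OF u _ _ x y])
    fix k :: int assume "act (u [^] k) (act \<gamma> q) = act \<gamma> q"
    moreover have "u [^] k \<otimes> \<gamma> = \<gamma> \<otimes> t [^] k"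
      using conj_pow[OF \<gamma> t, of k] \<gamma> t by (simp add: u_def acting.m_assoc)
    ultimately have "act \<gamma> (act (t [^] k) q) = act \<gamma> q"
      using \<gamma> t u qP by (simp flip: composition_rule)
    then show "k = 0"
      using \<gamma> t q action_inj[of \<gamma> "act (t [^] k) q" q] by (auto simp: torsion_def action_closed)
  next
    fix n :: nat
    show "invariant_at u x (act (u [^] int n) (act \<gamma> q))"
      using u_inv Q u \<gamma> qQ by simp
    have "act (u [^] int n) (act \<gamma> q) \<in> P" using u \<gamma> qP by (simp add: action_closed)
    then show "invariant_at u y (act (u [^] int n) (act \<gamma> q))"
      using y_inv[of "act (inv \<gamma>) (act (u [^] int n) (act \<gamma> q))"] \<gamma>
      by (simp add: action_closed action_inv_right)
  qed (use \<gamma> qP in \<open>simp add: action_closed\<close>)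
  then show ?thesis using y_at[OF qP] by (simp add: invariant_at_def)
qed

text \<open>In each orbit inside \<open>F\<close>, take a vector over a representative \<open>r\<close> that is fixed by the stabilizer of
  \<open>r\<close>, and transport it to the other points. The result does not depend on the
  transporting elements, as two of them differ by an element of the stabilizer.\<close>

lemma extend_over_finite_invariant_set:
  assumes F: "finite F" "F \<subseteq> P" and F_inv: "\<And>\<gamma> p. \<gamma> \<in> carrier \<Gamma> \<Longrightarrow> p \<in> F \<Longrightarrow> act \<gamma> p \<in> F"
    and x: "x \<in> sections"
    and x_inv: "\<And>\<gamma> p. \<gamma> \<in> carrier \<Gamma> \<Longrightarrow> p \<in> P - F \<Longrightarrow> invariant_at \<gamma> x p"
    and stab: "\<And>p. p \<in> P \<Longrightarrow> finite (orbit \<Gamma> act p) \<Longrightarrow>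
      \<exists>v\<in>X\<^sub>0. \<forall>\<gamma>\<in>stabilizer \<Gamma> act p. fib \<gamma> p v = v"
  shows "\<exists>z\<in>sections. \<forall>\<gamma>\<in>carrier \<Gamma>. \<forall>p\<in>P. invariant_at \<gamma> z p"
proof -
  have "\<exists>v\<in>X\<^sub>0. \<forall>\<gamma>\<in>stabilizer \<Gamma> act p. fib \<gamma> p v = v" if p: "p \<in> F" for p
  proof (rule stab)
    show "finite (orbit \<Gamma> act p)"
      by (rule finite_subset[OF _ F(1)]) (auto simp: orbit_def F_inv p)
  qed (use p F in auto)
  then obtain v where v: "\<And>p. p \<in> F \<Longrightarrow> v p \<in> X\<^sub>0"
      "\<And>p \<gamma>. p \<in> F \<Longrightarrow> \<gamma> \<in> stabilizer \<Gamma> act p \<Longrightarrow> fib \<gamma> p (v p) = v p"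
    by metis
  define rep where "rep = (\<lambda>q. SOME r. r \<in> orbit \<Gamma> act q)"
  have rep: "\<exists>\<gamma>. \<gamma> \<in> carrier \<Gamma> \<and> act \<gamma> (rep q) = q" "rep q \<in> F" if q: "q \<in> F" for q
  proof -
    have "rep q \<in> orbit \<Gamma> act q"
      unfolding rep_def by (rule someI[of _ q]) (use orbit_refl q F in auto)
    then obtain \<gamma> where \<gamma>: "\<gamma> \<in> carrier \<Gamma>" "act \<gamma> q = rep q" by (auto simp: orbit_def)
    then show "rep q \<in> F" using F_inv q by metis
    have "act (inv \<gamma>) (rep q) = q" using \<gamma> q F by (auto simp: action_inv_left simp flip: \<gamma>(2))
    then show "\<exists>\<gamma>. \<gamma> \<in> carrier \<Gamma> \<and> act \<gamma> (rep q) = q" using \<gamma> by blast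
  qed
  have rep_act: "rep (act \<gamma> q) = rep q" if "\<gamma> \<in> carrier \<Gamma>" "q \<in> F" for \<gamma> q
  proof -
    have qP: "q \<in> P" "act \<gamma> q \<in> P" using that F F_inv by auto
    have "act \<gamma> q \<in> orbit \<Gamma> act q" using that by (auto simp: orbit_def)
    moreover have "orbit \<Gamma> act p \<subseteq> P" if "p \<in> P" for p
      using that by (auto simp: orbit_def action_closed)
    ultimately have "orbit \<Gamma> act (act \<gamma> q) = orbit \<Gamma> act q"
      using qP orbit_trans orbit_sym by blast
    then show ?thesis by (simp add: rep_def)
  qed
  obtain w where w: "\<And>q. q \<in> F \<Longrightarrow> w q \<in> carrier \<Gamma>" "\<And>q. q \<in> F \<Longrightarrow> act (w q) (rep q) = q"
    using rep(1) by metis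
  define z where "z = (\<lambda>q. if q \<in> F then fib (w q) (rep q) (v (rep q)) else x q)"
  have "invariant_at \<gamma> z q" if \<gamma>: "\<gamma> \<in> carrier \<Gamma>" and q: "q \<in> P" for \<gamma> q
  proof (cases "q \<in> F")
    case True
    let ?r = "rep q" and ?w = "w (act \<gamma> q)"
    have \<gamma>q: "act \<gamma> q \<in> F" using F_inv \<gamma> True by blast
    have r: "?r \<in> F" "?r \<in> P" "v ?r \<in> X\<^sub>0" using rep True F v by auto
    have wc: "?w \<in> carrier \<Gamma>" "act ?w ?r = act \<gamma> q" "w q \<in> carrier \<Gamma>" "act (w q) ?r = q"
      using w \<gamma>q True rep_act[OF \<gamma> True] by metis+
    define \<delta> where "\<delta> = inv ?w \<otimes> (\<gamma> \<otimes> w q)"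
    have \<delta>: "\<delta> \<in> carrier \<Gamma>" "?w \<otimes> \<delta> = \<gamma> \<otimes> w q"
      using wc \<gamma> by (simp_all add: \<delta>_def flip: acting.m_assoc)
    have "act \<delta> ?r = ?r"
      using wc \<gamma> r action_inv_left[of ?w ?r] by (simp add: \<delta>_def composition_rule action_closed)
    then have \<delta>r: "\<delta> \<in> stabilizer \<Gamma> act ?r" "act \<delta> ?r = ?r" using \<delta> by (auto simp: stabilizer_def)
    have "fib \<gamma> q (fib (w q) ?r (v ?r)) = fib (?w \<otimes> \<delta>) ?r (v ?r)"
      using wc \<gamma> r by (simp add: \<delta>(2) fib_mult)
    also have "\<dots> = fib ?w ?r (v ?r)"
      using wc \<delta> \<delta>r r v(2)[OF r(1) \<delta>r(1)] by (subst fib_mult) auto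
    finally show ?thesis
      using True \<gamma>q rep_act[OF \<gamma> True] by (simp add: invariant_at_def z_def)
  next
    case False
    have "act \<gamma> q \<notin> F"
      using F_inv[of "inv \<gamma>" "act \<gamma> q"] False \<gamma> q by (auto simp: action_inv_left)
    then show ?thesis
      using x_inv[of \<gamma> q] False \<gamma> q by (simp add: invariant_at_def z_def)
  qed
  moreover have "z \<in> sections"
  proof -
    have "finite ({p \<in> P. x p \<noteq> x\<^sub>0} \<union> F)" using F x by (simp add: sections_def)
    then have "finite {p \<in> P. z p \<noteq> x\<^sub>0}" by (rule rev_finite_subset) (auto simp: z_def)
    moreover have "z p \<in> X\<^sub>0" if "p \<in> P" for p
      using that x rep w v F by (auto simp: z_def sections_closed intro!: fib_closed)
    ultimately show ?thesis by (simp add: sections_def)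
  qed
  ultimately show ?thesis by blast
qed

text \<open>The constant section \<open>x\<^sub>0\<close> is invariant outside the finitely many points where a generator fails to
  preserve it, and every subset of \<open>P\<close> is invariant under a trivial action.\<close>

lemma invariant_section_trivial:
  assumes fg: "finitely_generated \<Gamma>"
    and triv: "\<And>\<gamma> p. \<gamma> \<in> carrier \<Gamma> \<Longrightarrow> p \<in> P \<Longrightarrow> act \<gamma> p = p"
    and stab: "\<And>p. p \<in> P \<Longrightarrow> finite (orbit \<Gamma> act p) \<Longrightarrow>
      \<exists>v\<in>X\<^sub>0. \<forall>\<gamma>\<in>stabilizer \<Gamma> act p. fib \<gamma> p v = v"
  shows "\<exists>z\<in>sections. \<forall>\<gamma>\<in>carrier \<Gamma>. \<forall>p\<in>P. invariant_at \<gamma> z p"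
proof -
  obtain S where S: "finite S" "S \<subseteq> carrier \<Gamma>" "generate \<Gamma> S = carrier \<Gamma>"
    using fg by (auto simp: finitely_generated_def)
  let ?x = "\<lambda>_::'p. x\<^sub>0"
  define F where "F = (\<Union>s\<in>S. {p \<in> P. \<not> invariant_at s ?x p})"
  have x: "?x \<in> sections" by (simp add: sections_def base_closed)
  have F: "finite F" "F \<subseteq> P" using S finite_defects[OF x] by (auto simp: F_def)
  have "subgroup {\<gamma> \<in> carrier \<Gamma>. \<forall>p\<in>P - F. invariant_at \<gamma> ?x p} \<Gamma>"
    by (rule invariant_subgroup[OF x]) (auto simp: triv)
  moreover have "S \<subseteq> {\<gamma> \<in> carrier \<Gamma>. \<forall>p\<in>P - F. invariant_at \<gamma> ?x p}"
    using S by (auto simp: F_def)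
  ultimately have "carrier \<Gamma> \<subseteq> {\<gamma> \<in> carrier \<Gamma>. \<forall>p\<in>P - F. invariant_at \<gamma> ?x p}"
    using acting.generate_subgroup_incl S(3) by metis
  then have inv: "invariant_at \<gamma> ?x p" if "\<gamma> \<in> carrier \<Gamma>" "p \<in> P - F" for \<gamma> p
    using that by blast
  show ?thesis
    by (rule extend_over_finite_invariant_set[OF F _ x inv stab]) (use F triv in auto)
qed

lemma invariant_section_abelian:
  assumes elliptic: "\<And>\<gamma>. \<gamma> \<in> carrier \<Gamma> \<Longrightarrow> \<exists>z\<in>sections. \<forall>p\<in>P. invariant_at \<gamma> z p"
    and t: "t \<in> carrier \<Gamma>" and fin: "finite (torsion t)"
    and comm: "\<And>\<gamma> p. \<gamma> \<in> carrier \<Gamma> \<Longrightarrow> p \<in> P \<Longrightarrow>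
      act t (act (\<gamma> \<otimes> t \<otimes> inv \<gamma>) p) = act (\<gamma> \<otimes> t \<otimes> inv \<gamma>) (act t p)"
    and stab: "\<And>p. p \<in> P \<Longrightarrow> finite (orbit \<Gamma> act p) \<Longrightarrow>
      \<exists>v\<in>X\<^sub>0. \<forall>\<gamma>\<in>stabilizer \<Gamma> act p. fib \<gamma> p v = v"
  shows "\<exists>z\<in>sections. \<forall>\<gamma>\<in>carrier \<Gamma>. \<forall>p\<in>P. invariant_at \<gamma> z p"
proof -
  obtain x where x: "x \<in> sections" "\<And>p. p \<in> P \<Longrightarrow> invariant_at t x p"
    using elliptic[OF t] by blast
  have sub: "torsion t \<subseteq> P" by (auto simp: torsion_def)
  show ?thesis
    by (rule extend_over_finite_invariant_set[OF fin sub torsion_invariant[OF t fin comm] x(1)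
          invariant_off_torsion[OF elliptic t fin comm x] stab])
qed

end

section \<open>The wreath product as a fibred action\<close>

text \<open>If \<open>t\<^sup>m x = x\<close> with \<open>m \<noteq> 0\<close>, the \<open>t\<close>-orbit of \<open>x\<close> is finite, because \<open>t\<^sup>k x\<close> depends on \<open>k mod m\<close>
  only.\<close>

lemma (in group_action) finite_cyclic_torsion:
  assumes t: "t \<in> carrier G" and fin: "finite {Q \<in> element_orbits G E \<phi> t. finite Q}"
  shows "finite {x \<in> E. \<exists>k::int. k \<noteq> 0 \<and> \<phi> (t [^] k) x = x}" (is "finite ?T")
proof -
  let ?orb = "orbit (G\<lparr>carrier := generate G {t}\<rparr>) \<phi>"
  have orb: "?orb x = range (\<lambda>k::int. \<phi> (t [^] k) x)" for x
    by (auto simp: orbit_def acting.generate_pow[OF t])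
  have "x \<in> \<Union> {Q \<in> element_orbits G E \<phi> t. finite Q}" if x: "x \<in> ?T" for x
  proof -
    obtain m :: int where m: "m \<noteq> 0" "\<phi> (t [^] m) x = x" and xE: "x \<in> E" using x by blast
    have period: "\<phi> (t [^] k) x = \<phi> (t [^] (k mod m)) x" for k :: int
    proof -
      have "t [^] k = t [^] (k mod m) \<otimes> (t [^] m) [^] (k div m)"
        using t by (simp add: acting.int_pow_pow flip: acting.int_pow_mult)
      then show ?thesis
        using t xE m action_pow_fixed[of "t [^] m" x "k div m"] by (simp add: composition_rule)
    qed
    have "?orb x \<subseteq> (\<lambda>k::int. \<phi> (t [^] k) x) ` {-\<bar>m\<bar>..\<bar>m\<bar>}"
      unfolding orb
    proof (rule image_subsetI)
      fix k :: int
      have "k mod m \<in> {-\<bar>m\<bar>..\<bar>m\<bar>}"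
        using abs_mod_less[OF m(1), of k] by (simp add: abs_less_iff)
      then show "\<phi> (t [^] k) x \<in> (\<lambda>k::int. \<phi> (t [^] k) x) ` {-\<bar>m\<bar>..\<bar>m\<bar>}"
        by (subst period) (rule imageI)
    qed
    then have "finite (?orb x)" using finite_subset by blast
    moreover have "?orb x \<in> element_orbits G E \<phi> t"
      using xE by (auto simp: element_orbits_def orbits_def)
    moreover have "x \<in> ?orb x"
      unfolding orb using xE by (auto simp: action_one intro!: image_eqI[of _ _ 0])
    ultimately show ?thesis by blast
  qed
  then have "?T \<subseteq> \<Union> {Q \<in> element_orbits G E \<phi> t. finite Q}" by blast
  moreover have "finite (\<Union> {Q \<in> element_orbits G E \<phi> t. finite Q})" using fin by blast
  ultimately show ?thesis using finite_subset by blast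
qed


lemma plus_action_fixed_iff:
  assumes G0: "group_action G\<^sub>0 X\<^sub>0 \<phi>" and H: "group_action H P \<rho>"
    and \<gamma>: "\<gamma> \<in> carrier (wreath_product G\<^sub>0 H P \<rho>)" and x: "x \<in> restricted_product X\<^sub>0 x\<^sub>0 P"
  shows "plus_action X\<^sub>0 \<phi> x\<^sub>0 H P \<rho> \<gamma> x = x \<longleftrightarrow>
    (\<forall>p\<in>P. \<phi> (fst \<gamma> (\<rho> (snd \<gamma>) p)) (x p) = x (\<rho> (snd \<gamma>) p))"
proof -
  interpret h: group_action H P \<rho> by (rule H)
  obtain g h where gh: "\<gamma> = (g, h)" "h \<in> carrier H" using \<gamma> by (auto simp: wreath_product_def)
  have xE: "x \<in> (\<Pi>\<^sub>E p\<in>P. X\<^sub>0)" using x by (simp add: restricted_product_def)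
  have act: "plus_action X\<^sub>0 \<phi> x\<^sub>0 H P \<rho> \<gamma> x = (\<lambda>q\<in>P. \<phi> (g q) (x (\<rho> (inv\<^bsub>H\<^esub> h) q)))"
    using x xE by (auto simp: plus_action_def wreath_action_def gh shift_def)
  have "plus_action X\<^sub>0 \<phi> x\<^sub>0 H P \<rho> \<gamma> x = x \<longleftrightarrow> (\<forall>q\<in>P. \<phi> (g q) (x (\<rho> (inv\<^bsub>H\<^esub> h) q)) = x q)"
    using xE unfolding act by (force simp: fun_eq_iff PiE_iff extensional_def)
  also have "\<dots> \<longleftrightarrow> (\<forall>q\<in>\<rho> h ` P. \<phi> (g q) (x (\<rho> (inv\<^bsub>H\<^esub> h) q)) = x q)"
    by (simp only: h.surj_prop[OF gh(2)])
  also have "\<dots> \<longleftrightarrow> (\<forall>p\<in>P. \<phi> (g (\<rho> h p)) (x p) = x (\<rho> h p))"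
    using gh(2) by (simp add: h.action_inv_left)
  finally show ?thesis by (simp add: gh(1))
qed

lemma wreath_subgroup_projection:
  assumes G0: "group_action G\<^sub>0 X\<^sub>0 \<phi>" and H: "group_action H P \<rho>"
    and \<Gamma>: "subgroup \<Gamma> (G_plus G\<^sub>0 X\<^sub>0 \<phi> x\<^sub>0 H P \<rho>)"
  shows "group_hom ((G_plus G\<^sub>0 X\<^sub>0 \<phi> x\<^sub>0 H P \<rho>)\<lparr>carrier := \<Gamma>\<rparr>) H snd"
proof -
  interpret h: group_action H P \<rho> by (rule H)
  interpret gp: group_action "G_plus G\<^sub>0 X\<^sub>0 \<phi> x\<^sub>0 H P \<rho>" "restricted_product X\<^sub>0 x\<^sub>0 P"
    "plus_action X\<^sub>0 \<phi> x\<^sub>0 H P \<rho>" by (rule group_action_G_plus[OF G0 H])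
  have "snd \<in> hom ((G_plus G\<^sub>0 X\<^sub>0 \<phi> x\<^sub>0 H P \<rho>)\<lparr>carrier := \<Gamma>\<rparr>) H"
    using subgroup.subset[OF \<Gamma>] by (auto simp: hom_def G_plus_def wreath_product_def)
  then show ?thesis
    using gp.acting.subgroup_imp_group[OF \<Gamma>] h.acting.is_group
    by (simp add: group_hom_def group_hom_axioms_def)
qed

lemma fibred_action_wreath:
  assumes G0: "group_action G\<^sub>0 X\<^sub>0 \<phi>" and x0: "x\<^sub>0 \<in> X\<^sub>0" and H: "group_action H P \<rho>"
    and \<Gamma>: "subgroup \<Gamma> (G_plus G\<^sub>0 X\<^sub>0 \<phi> x\<^sub>0 H P \<rho>)"
  shows "fibred_action ((G_plus G\<^sub>0 X\<^sub>0 \<phi> x\<^sub>0 H P \<rho>)\<lparr>carrier := \<Gamma>\<rparr>) P (\<lambda>\<gamma>. \<rho> (snd \<gamma>))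
    X\<^sub>0 x\<^sub>0 (\<lambda>\<gamma> p. \<phi> (fst \<gamma> (\<rho> (snd \<gamma>) p)))"
proof -
  let ?\<Gamma> = "(G_plus G\<^sub>0 X\<^sub>0 \<phi> x\<^sub>0 H P \<rho>)\<lparr>carrier := \<Gamma>\<rparr>"
  let ?W = "wreath_product G\<^sub>0 H P \<rho>"
  interpret g: group_action G\<^sub>0 X\<^sub>0 \<phi> by (rule G0)
  interpret h: group_action H P \<rho> by (rule H)
  interpret proj: group_hom ?\<Gamma> H snd by (rule wreath_subgroup_projection[OF G0 H \<Gamma>])
  have \<Gamma>W: "\<Gamma> \<subseteq> carrier ?W"
    using subgroup.subset[OF \<Gamma>] by (auto simp: G_plus_def)
  have car: "fst \<gamma> \<in> (\<Pi>\<^sub>E p\<in>P. carrier G\<^sub>0)" "snd \<gamma> \<in> carrier H" if "\<gamma> \<in> \<Gamma>" for \<gamma>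
    using subsetD[OF \<Gamma>W that] by (simp_all add: wreath_product_def mem_Times_iff)
  have coord: "fst \<gamma> p \<in> carrier G\<^sub>0" if "\<gamma> \<in> \<Gamma>" "p \<in> P" for \<gamma> p
    using car(1)[OF that(1)] that(2) by auto
  have "group_hom ?\<Gamma> (BijGroup P) (\<lambda>\<gamma>. \<rho> (snd \<gamma>))"
    using group_hom.homh[OF h.group_hom] proj.homh hom_compose[of snd ?\<Gamma> H \<rho> "BijGroup P"]
    by (simp add: group_hom_def group_hom_axioms_def proj.G.is_group group_BijGroup comp_def)
  then have act: "group_action ?\<Gamma> P (\<lambda>\<gamma>. \<rho> (snd \<gamma>))"
    by (simp add: group_action_def)
  show ?thesis
  proof (intro fibred_action.intro act fibred_action_axioms.intro x0)
    show "\<phi> (fst \<gamma> (\<rho> (snd \<gamma>) p)) v \<in> X\<^sub>0" if "\<gamma> \<in> carrier ?\<Gamma>" "p \<in> P" "v \<in> X\<^sub>0" for \<gamma> p v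
      using that car coord by (simp add: g.action_closed h.action_closed)
    show "\<phi> (fst \<one>\<^bsub>?\<Gamma>\<^esub> (\<rho> (snd \<one>\<^bsub>?\<Gamma>\<^esub>) p)) v = v" if "p \<in> P" "v \<in> X\<^sub>0" for p v
      using that by (simp add: G_plus_def wreath_product_def h.action_one g.action_one)
    show "\<phi> (fst (\<gamma> \<otimes>\<^bsub>?\<Gamma>\<^esub> \<delta>) (\<rho> (snd (\<gamma> \<otimes>\<^bsub>?\<Gamma>\<^esub> \<delta>)) p)) v =
        \<phi> (fst \<gamma> (\<rho> (snd \<gamma>) (\<rho> (snd \<delta>) p))) (\<phi> (fst \<delta> (\<rho> (snd \<delta>) p)) v)"
      if "\<gamma> \<in> carrier ?\<Gamma>" "\<delta> \<in> carrier ?\<Gamma>" "p \<in> P" "v \<in> X\<^sub>0" for \<gamma> \<delta> p v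
    proof -
      let ?q = "\<rho> (snd \<delta>) p"
      have q: "?q \<in> P" "\<rho> (snd \<gamma>) ?q \<in> P" using that car by (auto simp: h.action_closed)
      have "snd (\<gamma> \<otimes>\<^bsub>?\<Gamma>\<^esub> \<delta>) = snd \<gamma> \<otimes>\<^bsub>H\<^esub> snd \<delta>"
        using proj.hom_mult[OF that(1,2)] .
      then have "\<rho> (snd (\<gamma> \<otimes>\<^bsub>?\<Gamma>\<^esub> \<delta>)) p = \<rho> (snd \<gamma>) ?q"
        using that car by (simp add: h.composition_rule)
      moreover have "fst (\<gamma> \<otimes>\<^bsub>?\<Gamma>\<^esub> \<delta>) (\<rho> (snd \<gamma>) ?q) = fst \<gamma> (\<rho> (snd \<gamma>) ?q) \<otimes>\<^bsub>G\<^sub>0\<^esub> fst \<delta> ?q"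
        using that q car h.action_inv_left[of "snd \<gamma>" ?q]
        by (auto simp: G_plus_def wreath_product_def shift_def split: prod.splits)
      ultimately show ?thesis
        using that q coord by (simp add: g.composition_rule)
    qed
    \<comment> \<open>The translate by \<open>\<gamma>\<close> of the base point \<open>c\<close> of \<open>X\<close> lies in \<open>X\<close>, and its coordinate at \<open>q\<close> is
      \<open>\<gamma>\<^sub>q x\<^sub>0\<close>.\<close>
    fix \<gamma> assume "\<gamma> \<in> carrier ?\<Gamma>"
    then have \<gamma>: "\<gamma> \<in> \<Gamma>" by simp
    define c where "c = (\<lambda>p\<in>P. x\<^sub>0)"
    have c: "c \<in> restricted_product X\<^sub>0 x\<^sub>0 P" using x0 by (auto simp: restricted_product_def c_def)
    have "wreath_action X\<^sub>0 \<phi> H P \<rho> \<gamma> c \<in> restricted_product X\<^sub>0 x\<^sub>0 P"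
      using \<gamma> subgroup.subset[OF \<Gamma>] c by (auto simp: G_plus_def)
    moreover have "wreath_action X\<^sub>0 \<phi> H P \<rho> \<gamma> c q = \<phi> (fst \<gamma> q) x\<^sub>0" if "q \<in> P" for q
      using that c \<gamma> car h.action_closed[of "inv\<^bsub>H\<^esub> snd \<gamma>" q]
      by (auto simp: wreath_action_def shift_def c_def restricted_product_def split: prod.splits)
    ultimately have fin: "finite {q \<in> P. \<phi> (fst \<gamma> q) x\<^sub>0 \<noteq> x\<^sub>0}"
      by (simp add: restricted_product_def cong: conj_cong)
    show "finite {p \<in> P. \<phi> (fst \<gamma> (\<rho> (snd \<gamma>) p)) x\<^sub>0 \<noteq> x\<^sub>0}"
    proof (rule finite_imageD)
      show "finite (\<rho> (snd \<gamma>) ` {p \<in> P. \<phi> (fst \<gamma> (\<rho> (snd \<gamma>) p)) x\<^sub>0 \<noteq> x\<^sub>0})"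
        by (rule finite_subset[OF _ fin]) (use car \<gamma> in \<open>auto simp: h.action_closed\<close>)
      show "inj_on (\<rho> (snd \<gamma>)) {p \<in> P. \<phi> (fst \<gamma> (\<rho> (snd \<gamma>) p)) x\<^sub>0 \<noteq> x\<^sub>0}"
        using h.inj_prop car \<gamma> by (rule_tac inj_on_subset[of _ P]) auto
    qed
  qed
qed

text \<open>On the stabilizer of \<open>p\<close> the coordinate \<open>\<gamma> \<mapsto> \<gamma>\<^sub>p\<close> is a homomorphism to \<open>G\<^sub>0\<close>. Its image \<open>K\<close> is finitely
  generated by Schreier's lemma, and each element of \<open>K\<close> fixes the coordinate at \<open>p\<close> of a point of \<open>X\<close>
  that is fixed by a preimage. So decency applies to \<open>K\<close>.\<close>

lemma stabilizer_fixes_fibre_point: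
  assumes dec: "decent_action G\<^sub>0 X\<^sub>0 \<phi>" and x0: "x\<^sub>0 \<in> X\<^sub>0" and H: "group_action H P \<rho>"
    and \<Gamma>: "subgroup \<Gamma> (G_plus G\<^sub>0 X\<^sub>0 \<phi> x\<^sub>0 H P \<rho>)"
    and fg: "finitely_generated ((G_plus G\<^sub>0 X\<^sub>0 \<phi> x\<^sub>0 H P \<rho>)\<lparr>carrier := \<Gamma>\<rparr>)"
    and ell: "purely_elliptic ((G_plus G\<^sub>0 X\<^sub>0 \<phi> x\<^sub>0 H P \<rho>)\<lparr>carrier := \<Gamma>\<rparr>)
          (restricted_product X\<^sub>0 x\<^sub>0 P) (plus_action X\<^sub>0 \<phi> x\<^sub>0 H P \<rho>)"
    and p: "p \<in> P"
    and fin: "finite (orbit ((G_plus G\<^sub>0 X\<^sub>0 \<phi> x\<^sub>0 H P \<rho>)\<lparr>carrier := \<Gamma>\<rparr>) (\<lambda>\<gamma>. \<rho> (snd \<gamma>)) p)"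
  shows "\<exists>v\<in>X\<^sub>0. \<forall>\<gamma>\<in>\<Gamma>. \<rho> (snd \<gamma>) p = p \<longrightarrow> \<phi> (fst \<gamma> p) v = v"
proof -
  let ?\<Gamma> = "(G_plus G\<^sub>0 X\<^sub>0 \<phi> x\<^sub>0 H P \<rho>)\<lparr>carrier := \<Gamma>\<rparr>"
  interpret g: decent_action G\<^sub>0 X\<^sub>0 \<phi> by (rule dec)
  have G0: "group_action G\<^sub>0 X\<^sub>0 \<phi>" ..
  interpret h: group_action H P \<rho> by (rule H)
  interpret fibred_action ?\<Gamma> P "\<lambda>\<gamma>. \<rho> (snd \<gamma>)" X\<^sub>0 x\<^sub>0 "\<lambda>\<gamma> p. \<phi> (fst \<gamma> (\<rho> (snd \<gamma>) p))"
    by (rule fibred_action_wreath[OF G0 x0 H \<Gamma>])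
  let ?stab = "stabilizer ?\<Gamma> (\<lambda>\<gamma>. \<rho> (snd \<gamma>)) p"
  have stab: "?stab = {\<gamma> \<in> \<Gamma>. \<rho> (snd \<gamma>) p = p}" by (simp add: stabilizer_def)
  have \<Gamma>W: "\<Gamma> \<subseteq> carrier (wreath_product G\<^sub>0 H P \<rho>)"
    using subgroup.subset[OF \<Gamma>] by (auto simp: G_plus_def)
  let ?S = "?\<Gamma>\<lparr>carrier := ?stab\<rparr>" and ?f = "\<lambda>\<gamma>. fst \<gamma> p"
  have grp: "group ?S" by (rule acting.subgroup_imp_group[OF stabilizer_subgroup[OF p]])
  have "?f \<in> hom ?S G\<^sub>0"
  proof (rule homI)
    show "fst \<gamma> p \<in> carrier G\<^sub>0" if "\<gamma> \<in> carrier ?S" for \<gamma>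
      using that \<Gamma>W p by (fastforce simp: stab wreath_product_def mem_Times_iff)
    show "fst (\<gamma> \<otimes>\<^bsub>?S\<^esub> \<delta>) p = fst \<gamma> p \<otimes>\<^bsub>G\<^sub>0\<^esub> fst \<delta> p" if "\<gamma> \<in> carrier ?S" "\<delta> \<in> carrier ?S" for \<gamma> \<delta>
    proof -
      have "\<rho> (snd \<gamma>) p = p" "snd \<gamma> \<in> carrier H"
        using that \<Gamma>W by (auto simp: stab wreath_product_def)
      then have "\<rho> (inv\<^bsub>H\<^esub> (snd \<gamma>)) p = p" using h.orbit_sym_aux p by blast
      then show ?thesis
        using p by (auto simp: G_plus_def wreath_product_def shift_def split: prod.splits)
    qed
  qed
  then interpret f: group_hom ?S G\<^sub>0 ?f
    using grp by (simp add: group_hom_def group_hom_axioms_def g.acting.is_group)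
  let ?K = "?f ` ?stab"
  have K: "subgroup ?K G\<^sub>0" using f.img_is_subgroup by simp
  have "finitely_generated ?S" by (rule finitely_generated_stabilizer[OF fg p fin])
  then obtain T where T: "finite T" "T \<subseteq> ?stab" "generate ?S T = ?stab"
    by (auto simp: finitely_generated_def)
  have "generate (G\<^sub>0\<lparr>carrier := ?K\<rparr>) (?f ` T) = ?K"
    using g.acting.generate_consistent[OF image_mono[OF T(2), of ?f] K] f.generate_img[of T] T(2,3)
    by simp
  then have "finitely_generated (G\<^sub>0\<lparr>carrier := ?K\<rparr>)"
    unfolding finitely_generated_def using T by (intro exI[of _ "?f ` T"]) auto
  moreover have "purely_elliptic (G\<^sub>0\<lparr>carrier := ?K\<rparr>) X\<^sub>0 \<phi>"
  proof -
    have "\<exists>y\<in>X\<^sub>0. \<phi> (fst \<gamma> p) y = y" if \<gamma>: "\<gamma> \<in> ?stab" for \<gamma>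
    proof -
      have \<gamma>': "\<gamma> \<in> \<Gamma>" "\<rho> (snd \<gamma>) p = p" using \<gamma> by (auto simp: stab)
      then obtain x where x: "x \<in> restricted_product X\<^sub>0 x\<^sub>0 P" "plus_action X\<^sub>0 \<phi> x\<^sub>0 H P \<rho> \<gamma> x = x"
        using ell by (auto simp: purely_elliptic_def)
      then have "\<phi> (fst \<gamma> p) (x p) = x p"
        using plus_action_fixed_iff[OF G0 H _ x(1), of \<gamma>] \<gamma>' \<Gamma>W p by force
      moreover have "x p \<in> X\<^sub>0" using x p by (auto simp: restricted_product_def)
      ultimately show ?thesis by blast
    qed
    then show ?thesis by (auto simp: purely_elliptic_def)
  qed
  ultimately have "fixes_point (G\<^sub>0\<lparr>carrier := ?K\<rparr>) X\<^sub>0 \<phi>"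
    by (rule g.purely_elliptic_fixes[OF K])
  then obtain v where v: "v \<in> X\<^sub>0" "\<forall>g\<in>carrier (G\<^sub>0\<lparr>carrier := ?K\<rparr>). \<phi> g v = v"
    unfolding fixes_point_def by blast
  have "\<phi> (fst \<gamma> p) v = v" if "\<gamma> \<in> ?stab" for \<gamma>
    using bspec[OF v(2), of "fst \<gamma> p"] imageI[OF that, of ?f] by simp
  then show ?thesis using v(1) unfolding stab by blast
qed

theorem lemma1p7:
  fixes G\<^sub>0 :: "('g, 'm) monoid_scheme" and X\<^sub>0 :: "'x set" and \<phi> :: "'g \<Rightarrow> 'x \<Rightarrow> 'x" and x\<^sub>0 :: 'x
    and H :: "('h, 'n) monoid_scheme" and P :: "'p set" and \<rho> :: "'h \<Rightarrow> 'p \<Rightarrow> 'p"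
    and \<Gamma> :: "(('p \<Rightarrow> 'g) \<times> 'h) set"
  assumes "decent_action G\<^sub>0 X\<^sub>0 \<phi>"
    and "x\<^sub>0 \<in> X\<^sub>0"
    and "group_action H P \<rho>"
    and "subgroup \<Gamma> (G_plus G\<^sub>0 X\<^sub>0 \<phi> x\<^sub>0 H P \<rho>)"
    and "finitely_generated ((G_plus G\<^sub>0 X\<^sub>0 \<phi> x\<^sub>0 H P \<rho>)\<lparr>carrier := \<Gamma>\<rparr>)"
    and "purely_elliptic ((G_plus G\<^sub>0 X\<^sub>0 \<phi> x\<^sub>0 H P \<rho>)\<lparr>carrier := \<Gamma>\<rparr>)
          (restricted_product X\<^sub>0 x\<^sub>0 P) (plus_action X\<^sub>0 \<phi> x\<^sub>0 H P \<rho>)"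
    and "snd ` \<Gamma> = {\<one>\<^bsub>H\<^esub>} \<or>
      (\<exists>A. A \<lhd> H\<lparr>carrier := snd ` \<Gamma>\<rparr> \<and> comm_group (H\<lparr>carrier := A\<rparr>) \<and>
        (\<exists>t\<in>A. finite {Q \<in> element_orbits H P \<rho> t. finite Q}))"
  shows "fixes_point ((G_plus G\<^sub>0 X\<^sub>0 \<phi> x\<^sub>0 H P \<rho>)\<lparr>carrier := \<Gamma>\<rparr>)
          (restricted_product X\<^sub>0 x\<^sub>0 P) (plus_action X\<^sub>0 \<phi> x\<^sub>0 H P \<rho>)"
proof -
  let ?\<Gamma> = "(G_plus G\<^sub>0 X\<^sub>0 \<phi> x\<^sub>0 H P \<rho>)\<lparr>carrier := \<Gamma>\<rparr>" and ?X = "restricted_product X\<^sub>0 x\<^sub>0 P"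
  note dec = assms(1) and x0 = assms(2) and H = assms(3) and \<Gamma> = assms(4) and fg = assms(5)
    and ell = assms(6)
  have G0: "group_action G\<^sub>0 X\<^sub>0 \<phi>" using dec by (rule decent_action.axioms)
  interpret h: group_action H P \<rho> by (rule H)
  interpret proj: group_hom ?\<Gamma> H snd by (rule wreath_subgroup_projection[OF G0 H \<Gamma>])
  interpret fibred_action ?\<Gamma> P "\<lambda>\<gamma>. \<rho> (snd \<gamma>)" X\<^sub>0 x\<^sub>0 "\<lambda>\<gamma> p. \<phi> (fst \<gamma> (\<rho> (snd \<gamma>) p))"
    by (rule fibred_action_wreath[OF G0 x0 H \<Gamma>])
  have \<Gamma>W: "\<Gamma> \<subseteq> carrier (wreath_product G\<^sub>0 H P \<rho>)"
    using subgroup.subset[OF \<Gamma>] by (auto simp: G_plus_def)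
  have fixed_iff: "plus_action X\<^sub>0 \<phi> x\<^sub>0 H P \<rho> \<gamma> x = x \<longleftrightarrow> (\<forall>p\<in>P. invariant_at \<gamma> x p)"
    if "\<gamma> \<in> \<Gamma>" "x \<in> ?X" for \<gamma> x
    using plus_action_fixed_iff[OF G0 H subsetD[OF \<Gamma>W that(1)] that(2)] by (simp add: invariant_at_def)
  have sub: "?X \<subseteq> sections" by (auto simp: restricted_product_def sections_def)
  have elliptic: "\<exists>z\<in>sections. \<forall>p\<in>P. invariant_at \<gamma> z p" if "\<gamma> \<in> carrier ?\<Gamma>" for \<gamma>
    using that ell fixed_iff sub unfolding purely_elliptic_def by fastforce
  have stab: "\<exists>v\<in>X\<^sub>0. \<forall>\<gamma>\<in>stabilizer ?\<Gamma> (\<lambda>\<gamma>. \<rho> (snd \<gamma>)) p. \<phi> (fst \<gamma> (\<rho> (snd \<gamma>) p)) v = v"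
    if p: "p \<in> P" "finite (orbit ?\<Gamma> (\<lambda>\<gamma>. \<rho> (snd \<gamma>)) p)" for p
  proof -
    obtain v where "v \<in> X\<^sub>0" "\<And>\<gamma>. \<gamma> \<in> \<Gamma> \<Longrightarrow> \<rho> (snd \<gamma>) p = p \<Longrightarrow> \<phi> (fst \<gamma> p) v = v"
      using stabilizer_fixes_fibre_point[OF dec x0 H \<Gamma> fg ell p] by blast
    then show ?thesis by (intro bexI[of _ v] ballI) (simp_all add: stabilizer_def)
  qed
  have "\<exists>z\<in>sections. \<forall>\<gamma>\<in>carrier ?\<Gamma>. \<forall>p\<in>P. invariant_at \<gamma> z p"
    using assms(7)
  proof (elim disjE exE conjE bexE)
    assume "snd ` \<Gamma> = {\<one>\<^bsub>H\<^esub>}"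
    then have "snd \<gamma> = \<one>\<^bsub>H\<^esub>" if "\<gamma> \<in> carrier ?\<Gamma>" for \<gamma>
      using that imageI[of \<gamma> \<Gamma> snd] by simp
    then have "\<rho> (snd \<gamma>) p = p" if "\<gamma> \<in> carrier ?\<Gamma>" "p \<in> P" for \<gamma> p
      using that h.action_one[of p] by simp
    from invariant_section_trivial[OF fg this stab] show ?thesis .
  next
    fix A t
    assume A: "A \<lhd> H\<lparr>carrier := snd ` \<Gamma>\<rparr>" and comm: "comm_group (H\<lparr>carrier := A\<rparr>)"
      and t: "t \<in> A" and fin: "finite {Q \<in> element_orbits H P \<rho> t. finite Q}"
    let ?L = "H\<lparr>carrier := snd ` \<Gamma>\<rparr>"
    interpret A: normal A ?L by (rule A)
    interpret C: comm_group "H\<lparr>carrier := A\<rparr>" by (rule comm)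
    have "snd \<in> hom ?\<Gamma> ?L" using proj.homh by (auto simp: hom_def)
    then interpret L: group_hom ?\<Gamma> ?L snd
      by (simp add: group_hom_def group_hom_axioms_def proj.G.is_group A.is_group)
    have "snd \<gamma> \<in> carrier H" if "\<gamma> \<in> \<Gamma>" for \<gamma> using proj.hom_closed[of \<gamma>] that by simp
    then have "snd ` \<Gamma> \<subseteq> carrier H" by blast
    then have AH: "A \<subseteq> carrier H" using A.subset by simp
    obtain \<tau> where \<tau>: "\<tau> \<in> carrier ?\<Gamma>" "snd \<tau> = t" using A.subset t by auto
    have "torsion \<tau> = {p \<in> P. \<exists>k::int. k \<noteq> 0 \<and> \<rho> (t [^]\<^bsub>H\<^esub> k) p = p}"
      unfolding torsion_def proj.hom_int_pow[OF \<tau>(1)] \<tau>(2) ..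
    then have tors: "finite (torsion \<tau>)" using h.finite_cyclic_torsion[OF _ fin] t AH by auto
    show ?thesis
    proof (rule invariant_section_abelian[OF elliptic \<tau>(1) tors _ stab])
      fix \<gamma> p assume \<gamma>: "\<gamma> \<in> carrier ?\<Gamma>" and p: "p \<in> P"
      let ?u = "\<gamma> \<otimes>\<^bsub>?\<Gamma>\<^esub> \<tau> \<otimes>\<^bsub>?\<Gamma>\<^esub> inv\<^bsub>?\<Gamma>\<^esub> \<gamma>"
      have "snd ?u = snd \<gamma> \<otimes>\<^bsub>?L\<^esub> t \<otimes>\<^bsub>?L\<^esub> inv\<^bsub>?L\<^esub> (snd \<gamma>)"
        using \<gamma> \<tau> by (simp only: L.hom_mult L.hom_inv proj.G.m_closed proj.G.inv_closed)
      then have u: "snd ?u \<in> A" using A.inv_op_closed2[of "snd \<gamma>" t] \<gamma> t by auto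
      then have "t \<otimes>\<^bsub>H\<^esub> snd ?u = snd ?u \<otimes>\<^bsub>H\<^esub> t" using C.m_comm[of t "snd ?u"] t by simp
      then show "\<rho> (snd \<tau>) (\<rho> (snd ?u) p) = \<rho> (snd ?u) (\<rho> (snd \<tau>) p)"
        using h.composition_rule[OF p, of t "snd ?u"] h.composition_rule[OF p, of "snd ?u" t] t u AH
        unfolding \<tau>(2) by auto
    qed
  qed
  then obtain z where z: "z \<in> sections" "\<And>\<gamma> p. \<gamma> \<in> carrier ?\<Gamma> \<Longrightarrow> p \<in> P \<Longrightarrow> invariant_at \<gamma> z p"
    by blast
  have "restrict z P \<in> ?X"
  proof -
    have "{p \<in> P. restrict z P p \<noteq> x\<^sub>0} = {p \<in> P. z p \<noteq> x\<^sub>0}" by auto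
    then show ?thesis using z(1) by (simp add: sections_def restricted_product_def)
  qed
  moreover have "invariant_at \<gamma> (restrict z P) p" if "\<gamma> \<in> \<Gamma>" "p \<in> P" for \<gamma> p
    using z(2)[of \<gamma> p] that action_closed[of \<gamma> p] by (simp add: invariant_at_def)
  ultimately show ?thesis
    unfolding fixes_point_def
    by (intro bexI[of _ "restrict z P"] ballI) (simp_all add: fixed_iff)
qed

end
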